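(* Let $X$ be an infinite-dimensional Fréchet space with a continuous norm, $Y$ a separable Fréchet space and $(T_n)_{n\ge 1}$ a sequence of continuous linear operators from $X$ to $Y$. Let $(p_n)_{n\ge 1}$ and $(q_n)_{n\ge 1}$ be sequences of seminorms defining the topology of $X$ and of $Y$, respectively. Suppose that $(T_n)$ satisfies condition (C) for an increasing sequence $(n_k)$ of positive integers and that there exists a non-increasing sequence $(M_j)_{j\ge 1}$ of infinite-dimensional closed subspaces of $X$ such that for every $n\ge 1$ there exist a positive number $C_n$ and two integers $m(n),k(n)\ge 1$ such that for any $j\ge k(n)$ and any $x\in M_j$, $$q_n(T_{n_j}x)\le C_n\, p_{m(n)}(x).$$ Then $(T_n)$ possesses a hypercyclic subspace.
   Context: A sequence $(T_n)$ of continuous linear operators $X\to Y$ satisfies condition (C) for an increasing sequence $(n_k)$ of positive integers if there exists a dense subset $X_0\subset X$ such that (1) $T_{n_k}x\to 0$ for every $x\in X_0$; and (2) for every continuous seminorm $p$ on $X$, the set $\bigcup_k T_{n_k}(\{x\in X: p(x)<1\})$ is dense in $Y$. A vector $x\in X$ is hypercyclic for $(T_n)$ if $\{T_nx: n\ge 1\}$ is dense in $Y$. A hypercyclic subspace for $(T_n)$ is an infinite-dimensional closed linear subspace of $X$ in which every non-zero vector is hypercyclic for $(T_n)$. "With a continuous norm" means that there is a norm on $X$ that is continuous for the topology of $X$. Non-increasing means $M_1\supset M_2\supset\cdots$. Scalars are real or complex. *)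

theory Defs
  imports "HOL-Analysis.Analysis"
begin

text \<open>
  The scalars range over types of sort \<open>{real_normed_field, euclidean_space}\<close>. Both \<^typ>\<open>real\<close> and
  \<^typ>\<open>complex\<close> are of this sort, and up to isometric isomorphism they are the only such fields
  (a finite-dimensional commutative field extension of the reals with multiplicative norm).
  All sequences are indexed by the integers \<open>n \<ge> 1\<close>; the value at \<open>0\<close> is never used.
\<close>

definition seminorm ::
  "('k::{real_normed_field, euclidean_space} \<Rightarrow> 'a::ab_group_add \<Rightarrow> 'a) \<Rightarrow> ('a \<Rightarrow> real) \<Rightarrow> bool" where
  "seminorm scl p \<longleftrightarrow>
     (\<forall>x y. p (x + y) \<le> p x + p y) \<and> (\<forall>c x. p (scl c x) = norm c * p x)"

text \<open>
  The sequence of seminorms is not required to be increasing, so basic neighbourhoods are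
  given by finitely many of the seminorms.
\<close>

definition seminorms_define_topology ::
  "('k::{real_normed_field, euclidean_space} \<Rightarrow> 'a::{ab_group_add, topological_space} \<Rightarrow> 'a)
     \<Rightarrow> (nat \<Rightarrow> 'a \<Rightarrow> real) \<Rightarrow> bool" where
  "seminorms_define_topology scl p \<longleftrightarrow>
     (\<forall>n\<ge>1. seminorm scl (p n)) \<and>
     (\<forall>U. open U \<longleftrightarrow>
        (\<forall>x\<in>U. \<exists>N\<ge>1. \<exists>e>0. {y. \<forall>n\<in>{1..N}. p n (y - x) < e} \<subseteq> U))"

text \<open>
  On a type of class \<open>uniform_topological_group_add\<close> the uniformity is determined by the topology:
  it is the translation-invariant one, as addition and negation are uniformly continuous. Hence
  completeness below is completeness as a topological vector space.
\<close>

locale frechet_space = vector_space scl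
  for scl :: "'k::{real_normed_field, euclidean_space}
    \<Rightarrow> 'a::{uniform_topological_group_add, topological_ab_group_add, t2_space} \<Rightarrow> 'a" +
  assumes ex_seminorms: "\<exists>p. seminorms_define_topology scl p"
    and complete_UNIV: "complete (UNIV :: 'a set)"

definition infinite_dimensional :: "('k::field \<Rightarrow> 'a::ab_group_add \<Rightarrow> 'a) \<Rightarrow> 'a set \<Rightarrow> bool" where
  "infinite_dimensional scl S \<longleftrightarrow> \<not> (\<exists>B. finite B \<and> S = module.span scl B)"

definition has_continuous_norm ::
  "('k::{real_normed_field, euclidean_space} \<Rightarrow> 'a::{ab_group_add, topological_space} \<Rightarrow> 'a) \<Rightarrow> bool"
  where
  "has_continuous_norm scl \<longleftrightarrow>
     (\<exists>p. seminorm scl p \<and> (\<forall>x. p x = 0 \<longrightarrow> x = 0) \<and> continuous_on UNIV p)"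

definition separable :: "'a::topological_space set \<Rightarrow> bool" where
  "separable S \<longleftrightarrow> (\<exists>D. countable D \<and> D \<subseteq> S \<and> S \<subseteq> closure D)"

definition condition_C ::
  "('k::{real_normed_field, euclidean_space} \<Rightarrow> 'a::{ab_group_add, topological_space} \<Rightarrow> 'a)
     \<Rightarrow> (nat \<Rightarrow> 'a \<Rightarrow> 'b::{zero, topological_space}) \<Rightarrow> (nat \<Rightarrow> nat) \<Rightarrow> bool" where
  "condition_C scl T nn \<longleftrightarrow>
     (\<exists>X0. closure X0 = UNIV \<and> (\<forall>x\<in>X0. (\<lambda>k. T (nn k) x) \<longlonglongrightarrow> 0)) \<and>
     (\<forall>p. seminorm scl p \<and> continuous_on UNIV p \<longrightarrow>
        closure (\<Union>k\<in>{1..}. T (nn k) ` {x. p x < 1}) = UNIV)"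

definition hypercyclic_vector :: "(nat \<Rightarrow> 'a \<Rightarrow> 'b::topological_space) \<Rightarrow> 'a \<Rightarrow> bool" where
  "hypercyclic_vector T x \<longleftrightarrow> closure ((\<lambda>n. T n x) ` {1..}) = UNIV"

definition hypercyclic_subspace ::
  "('k::field \<Rightarrow> 'a::{ab_group_add, topological_space} \<Rightarrow> 'a)
     \<Rightarrow> (nat \<Rightarrow> 'a \<Rightarrow> 'b::topological_space) \<Rightarrow> 'a set \<Rightarrow> bool" where
  "hypercyclic_subspace scl T M \<longleftrightarrow>
     module.subspace scl M \<and> closed M \<and> infinite_dimensional scl M \<and>
     (\<forall>x\<in>M. x \<noteq> 0 \<longrightarrow> hypercyclic_vector T x)"

end

theory Submission
  imports Defs
begin

text \<open>
  Put \<open>S j = T (n_j)\<close>. By the Hahn-Banach theorem one can choose basic vectors \<open>u i\<close> in the spaces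
  \<open>M j\<close> such that, for every \<open>n\<close>, the projections onto initial segments of length greater than \<open>n\<close> are
  bounded by 2 for the \<open>n\<close>-th seminorm; the continuous norm serves to bound the coefficients. Each
  \<open>u i\<close> is replaced by a nearby vector with null orbit, and tiny vectors \<open>z i\<close>, provided by condition
  (C), are added so that \<open>S (j i)\<close> sends \<open>z i\<close> close to a prescribed target. The
  perturbed sequence is still basic, so the sums of its convergent expansions form a closed subspace.
  If the coefficient of such a sum \<open>x\<close> at the coordinate of \<open>z i\<close> is \<open>c\<close>, then \<open>S (j i) x\<close> is close to
  \<open>c\<close> times the target: earlier terms are killed by the null orbits, later perturbations are tiny,
  and the tail of the expansion in the \<open>u k\<close> lies in \<open>M (j i)\<close>, where \<open>S (j i)\<close> is controlled.
\<close>

text \<open>The obstacle is that the two available kinds of control hold on opposite sides of the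
  diagonal. A basic vector \<open>u h\<close> is manageable under \<open>S (j i)\<close> only for h
  \<ge> i, where it lies in \<open>M (j i)\<close>; a vector with null orbit is manageable only
  under sufficiently late operators. Replacing \<open>u h\<close> by a null-orbit vector
  \<open>t h\<close> reconciles both: for i > h the null orbit is used, for i \<le> h only the small
  difference \<open>t h - u h\<close> is added to the basic tail.

  A non-zero sum is only known to have one non-zero coefficient. Hence each coordinate alone must
  receive kicks towards every target, and arbitrarily late ones, when all error terms have become
  small.

  A stage can treat only finitely many seminorms, because the vectors admissible later must still
  meet every infinite-dimensional subspace in infinite dimension; this is why the n-th seminorm
  controls only initial segments longer than n.

  The perturbation is harmless because coefficients are at most 4 times the norm of a basic sum and
  the total perturbation is at most 1/8, so the norm changes by at most one half.\<close>

lemma seminorm_add: "seminorm scl p \<Longrightarrow> p (x + y) \<le> p x + p y"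
  by (simp add: seminorm_def)

lemma seminorm_scale: "seminorm scl p \<Longrightarrow> p (scl c x) = norm c * p x"
  by (simp add: seminorm_def)

text \<open>Serves to exploit that the scalars have finite real dimension. The generators lie in
  \<open>W\<close> itself, so that they have preimages when \<open>W\<close> is the image of a
  map.\<close>

lemma finite_real_generators:
  fixes W :: "'v::euclidean_space set"
  shows "\<exists>B. finite B \<and> B \<subseteq> W \<and> (\<forall>x\<in>W. \<exists>r. x = (\<Sum>b\<in>B. r b *\<^sub>R b))"
proof -
  obtain B where B: "B \<subseteq> W" "independent B" "W \<subseteq> span B"
    by (rule maximal_independent_subset)
  moreover have fin: "finite B" using B(2) by (rule independent_imp_finite)
  ultimately show ?thesis
    using span_finite[OF fin] by (intro exI[of _ B]) auto
qed

locale normed_scalars = vector_space scl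
  for scl :: "'k::{real_normed_field, euclidean_space} \<Rightarrow> 'a::ab_group_add \<Rightarrow> 'a"
begin

lemma seminorm_zero: "seminorm scl p \<Longrightarrow> p 0 = 0"
  using seminorm_scale[of scl p 0 0] by simp

lemma seminorm_minus: "seminorm scl p \<Longrightarrow> p (- x) = p x"
  using seminorm_scale[of scl p "-1" x] by simp

lemma seminorm_ge_0: "seminorm scl p \<Longrightarrow> 0 \<le> p x"
  using seminorm_add[of scl p x "- x"] by (simp add: seminorm_zero seminorm_minus)

lemma seminorm_minus_commute: "seminorm scl p \<Longrightarrow> p (x - y) = p (y - x)"
  using seminorm_minus[of p "x - y"] by simp

lemma seminorm_diff: "seminorm scl p \<Longrightarrow> p (x - y) \<le> p x + p y"
  using seminorm_add[of scl p x "- y"] by (simp add: seminorm_minus)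

lemma seminorm_triangle_sub: "seminorm scl p \<Longrightarrow> p x \<le> p y + p (x - y)"
  using seminorm_add[of scl p y "x - y"] by simp

lemma seminorm_sum: "seminorm scl p \<Longrightarrow> p (sum g A) \<le> (\<Sum>i\<in>A. p (g i))"
proof (induction A rule: infinite_finite_induct)
  case (insert x F)
  then show ?case
    using seminorm_add[of scl p "g x" "sum g F"] by fastforce
qed (simp_all add: seminorm_zero)

section \<open>Norming functionals\<close>

definition real_functional :: "('a \<Rightarrow> real) \<Rightarrow> bool" where
  "real_functional f \<longleftrightarrow>
     (\<forall>x y. f (x + y) = f x + f y) \<and> (\<forall>r x. f (scl (of_real r) x) = r * f x)"

definition sublinear :: "('a \<Rightarrow> real) \<Rightarrow> bool" where
  "sublinear s \<longleftrightarrow>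
     (\<forall>x y. s (x + y) \<le> s x + s y) \<and> (\<forall>t>0. \<forall>x. s (scl (of_real t) x) \<le> t * s x)"

lemma sublinear_add: "sublinear s \<Longrightarrow> s (x + y) \<le> s x + s y"
  by (simp add: sublinear_def)

lemma sublinear_scale_le: "sublinear s \<Longrightarrow> t > 0 \<Longrightarrow> s (scl (of_real t) x) \<le> t * s x"
  by (simp add: sublinear_def)

lemma sublinear_zero: "sublinear s \<Longrightarrow> s 0 = 0"
  using sublinear_scale_le[of s 2 0] sublinear_scale_le[of s "1/2" 0] by simp

lemma sublinear_scale:
  assumes "sublinear s" "t \<ge> 0"
  shows "s (scl (of_real t) x) = t * s x"
proof (cases "t = 0")
  case False
  have "s (scl (of_real (1/t)) (scl (of_real t) x)) \<le> (1/t) * s (scl (of_real t) x)"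
    using assms False by (intro sublinear_scale_le) auto
  moreover have "scl (of_real (1/t)) (scl (of_real t) x) = x"
    using False by simp
  ultimately have "t * s x \<le> s (scl (of_real t) x)"
    using assms False by (simp add: field_simps)
  with sublinear_scale_le[of s t x] assms False show ?thesis by simp
qed (use assms in \<open>simp add: sublinear_zero\<close>)

lemma sublinear_neg: "sublinear s \<Longrightarrow> - s (- x) \<le> s x"
  using sublinear_add[of s x "- x"] by (simp add: sublinear_zero)

text \<open>
  Passing from \<open>s\<close> to \<open>lower_shift s y\<close> gives the largest sublinear functional below \<open>s\<close> that is
  at most \<open>- s y\<close> at \<open>- y\<close>. A minimal sublinear functional is fixed by all these shifts, hence is
  additive.
\<close>

definition lower_shift :: "('a \<Rightarrow> real) \<Rightarrow> 'a \<Rightarrow> 'a \<Rightarrow> real" where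
  "lower_shift s y x = (INF t\<in>{0..}. s (x + scl (of_real t) y) - t * s y)"

lemma lower_shift_bound:
  assumes "sublinear s" "t \<ge> 0"
  shows "lower_shift s y x \<le> s (x + scl (of_real t) y) - t * s y"
  unfolding lower_shift_def
proof (rule cINF_lower)
  show "bdd_below ((\<lambda>t. s (x + scl (of_real t) y) - t * s y) ` {0..})"
  proof (rule bdd_belowI2)
    fix t :: real assume "t \<in> {0..}"
    \<comment> \<open>The points \<open>- x\<close> and \<open>x + t y\<close> add up to
      \<open>t y\<close>, so subadditivity gives a lower bound independent of
      \<open>t\<close>.\<close>
    then show "- s (- x) \<le> s (x + scl (of_real t) y) - t * s y"
      using sublinear_add[OF assms(1), of "- x" "x + scl (of_real t) y"]
      by (simp add: sublinear_scale assms(1))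
  qed
qed (use assms in auto)

lemma lower_shift_greatest:
  assumes "\<And>t. t \<ge> 0 \<Longrightarrow> b \<le> s (x + scl (of_real t) y) - t * s y"
  shows "b \<le> lower_shift s y x"
  unfolding lower_shift_def by (rule cINF_greatest) (use assms in auto)

text \<open>Parameters chosen for two points add up, so the two infima may be taken separately; the
  substitution of \<open>c * t\<close> for \<open>t\<close> gives homogeneity.\<close>

lemma sublinear_lower_shift:
  assumes s: "sublinear s"
  shows "sublinear (lower_shift s y)"
  unfolding sublinear_def
proof (intro conjI allI impI)
  fix x1 x2
  have "lower_shift s y (x1 + x2) - (s (x1 + scl (of_real t1) y) - t1 * s y) \<le> lower_shift s y x2"
    if "t1 \<ge> 0" for t1
  proof (rule lower_shift_greatest)
    fix t2 :: real assume "t2 \<ge> 0"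
    then have "lower_shift s y (x1 + x2) \<le> s ((x1 + x2) + scl (of_real (t1 + t2)) y) - (t1 + t2) * s y"
      using that by (intro lower_shift_bound s) auto
    also have "(x1 + x2) + scl (of_real (t1 + t2)) y = (x1 + scl (of_real t1) y) + (x2 + scl (of_real t2) y)"
      by (simp add: scale_left_distrib)
    finally show "lower_shift s y (x1 + x2) - (s (x1 + scl (of_real t1) y) - t1 * s y)
        \<le> s (x2 + scl (of_real t2) y) - t2 * s y"
      using sublinear_add[OF s, of "x1 + scl (of_real t1) y" "x2 + scl (of_real t2) y"]
      by (simp add: algebra_simps)
  qed
  then have "lower_shift s y (x1 + x2) - lower_shift s y x2 \<le> lower_shift s y x1"
    by (intro lower_shift_greatest) (simp add: algebra_simps)
  then show "lower_shift s y (x1 + x2) \<le> lower_shift s y x1 + lower_shift s y x2" by simp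
next
  fix c :: real and x assume c: "c > 0"
  have "(1/c) * lower_shift s y (scl (of_real c) x) \<le> lower_shift s y x"
  proof (rule lower_shift_greatest)
    fix t :: real assume t: "t \<ge> 0"
    have "lower_shift s y (scl (of_real c) x)
        \<le> s (scl (of_real c) x + scl (of_real (c * t)) y) - (c * t) * s y"
      using c t by (intro lower_shift_bound s) auto
    also have "scl (of_real c) x + scl (of_real (c * t)) y = scl (of_real c) (x + scl (of_real t) y)"
      by (simp add: scale_right_distrib)
    also have "s \<dots> = c * s (x + scl (of_real t) y)"
      using c by (simp add: sublinear_scale s)
    finally show "(1/c) * lower_shift s y (scl (of_real c) x) \<le> s (x + scl (of_real t) y) - t * s y"
      using c by (simp add: field_simps)
  qed
  then show "lower_shift s y (scl (of_real c) x) \<le> c * lower_shift s y x"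
    using c by (simp add: field_simps)
qed

text \<open>Minimality forces \<open>lower_shift s y = s\<close>; at \<open>t = 1\<close> this reads
  \<open>s x \<le> s (x + y) - s y\<close>, the missing half of additivity.\<close>

lemma minimal_sublinear_linear:
  assumes s: "sublinear s" and min: "\<And>s'. sublinear s' \<Longrightarrow> s' \<le> s \<Longrightarrow> s' = s"
  shows "real_functional s"
proof -
  have add: "s (x + y) = s x + s y" for x y
  proof -
    have "lower_shift s y \<le> s"
      using lower_shift_bound[OF s, of 0 y] by (intro le_funI) simp
    then have "lower_shift s y = s" by (intro min sublinear_lower_shift s)
    then show ?thesis
      using lower_shift_bound[OF s, of 1 y x] sublinear_add[OF s, of x y] by simp
  qed
  have neg: "s (- x) = - s x" for x
    using add[of x "- x"] by (simp add: sublinear_zero s)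
  have "s (scl (of_real r) x) = r * s x" for r x
  proof (cases "r \<ge> 0")
    case False
    then have "s (scl (of_real (- r)) x) = (- r) * s x" by (intro sublinear_scale s) simp
    then show ?thesis by (simp add: neg)
  qed (simp add: sublinear_scale s)
  with add show ?thesis by (simp add: real_functional_def)
qed

text \<open>Zorn's lemma for the sublinear functionals below \<open>p\<close> in the reversed order.
  Chains have pointwise infima because each such functional is at least \<open>- p (- x)\<close> at
  \<open>x\<close>.\<close>

theorem Hahn_Banach_sublinear:
  assumes p: "sublinear p"
  obtains f where "real_functional f" "f \<le> p"
proof -
  define A where "A = {s. sublinear s \<and> s \<le> p}"
  have low: "- p (- x) \<le> s x" if "s \<in> A" for s x
    using sublinear_neg[of s x] that unfolding A_def
    by (auto simp: le_fun_def intro: order.trans[of _ "- s (- x)"])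
  have "\<exists>m\<in>A. \<forall>a\<in>A. a \<le> m \<longrightarrow> a = m"
  proof (rule predicate_Zorn)
    show "partial_order_on A (relation_of (\<lambda>a b. b \<le> a) A)"
      by (rule partial_order_on_relation_ofI) auto
  next
    fix C assume "C \<in> Chains (relation_of (\<lambda>a b. b \<le> a) A)"
    then have CA: "C \<subseteq> A" and ch: "\<And>a b. a \<in> C \<Longrightarrow> b \<in> C \<Longrightarrow> a \<le> b \<or> b \<le> a"
      by (auto simp: Chains_def relation_of_def)
    show "\<exists>u\<in>A. \<forall>a\<in>C. u \<le> a"
    proof (cases "C = {}")
      case True
      then show ?thesis using p by (auto simp: A_def)
    next
      case False
      define u where "u x = (INF s\<in>C. s x)" for x
      have bdd: "bdd_below ((\<lambda>s. s x) ` C)" for x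
        using low CA by (intro bdd_belowI2[of _ "- p (- x)"]) auto
      have ule: "u x \<le> s x" if "s \<in> C" for s x
        unfolding u_def using that bdd by (intro cINF_lower)
      have ug: "b \<le> u x" if "\<And>s. s \<in> C \<Longrightarrow> b \<le> s x" for b x
        unfolding u_def using that False by (intro cINF_greatest)
      have sub: "sublinear u"
        unfolding sublinear_def
      proof (intro conjI allI impI)
        fix x y
        \<comment> \<open>Different members of the chain may be nearly minimal at \<open>x\<close>
          and at \<open>y\<close>; the smaller of the two serves for both points.\<close>
        have key: "u (x + y) \<le> s1 x + s2 y" if s12: "s1 \<in> C" "s2 \<in> C" for s1 s2
        proof -
          obtain s where s: "s \<in> C" "s \<le> s1" "s \<le> s2"
            using ch[OF s12] s12 by (metis order_refl)
          have "u (x + y) \<le> s (x + y)" by (rule ule) fact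
          also have "\<dots> \<le> s x + s y"
            using s CA by (intro sublinear_add) (auto simp: A_def)
          also have "\<dots> \<le> s1 x + s2 y"
            using s by (intro add_mono) (auto simp: le_fun_def)
          finally show ?thesis .
        qed
        have "u (x + y) - s1 x \<le> u y" if "s1 \<in> C" for s1
          using key[OF that] by (intro ug) (simp add: algebra_simps)
        then have "u (x + y) - u y \<le> u x"
          by (intro ug) (simp add: algebra_simps)
        then show "u (x + y) \<le> u x + u y" by simp
      next
        fix t :: real and x assume t: "t > 0"
        have "(1/t) * u (scl (of_real t) x) \<le> u x"
        proof (rule ug)
          fix s assume s: "s \<in> C"
          then have "u (scl (of_real t) x) \<le> t * s x"
            using ule[OF s, of "scl (of_real t) x"] CA t sublinear_scale_le[of s t x]
            by (auto simp: A_def)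
          then show "(1/t) * u (scl (of_real t) x) \<le> s x" using t by (simp add: field_simps)
        qed
        then show "u (scl (of_real t) x) \<le> t * u x" using t by (simp add: field_simps)
      qed
      obtain s where "s \<in> C" using False by blast
      then have "u \<le> p" using ule[of s] CA by (auto simp: A_def le_fun_def intro: order.trans)
      with sub show ?thesis using ule by (auto simp: A_def le_fun_def)
    qed
  qed
  then obtain f where f: "f \<in> A" and min: "\<And>a. a \<in> A \<Longrightarrow> a \<le> f \<Longrightarrow> a = f" by blast
  have "real_functional f"
    using f by (intro minimal_sublinear_linear min) (auto simp: A_def intro: order.trans)
  with f show thesis by (intro that) (auto simp: A_def)
qed

lemma seminorm_imp_sublinear: "seminorm scl p \<Longrightarrow> sublinear p"
  by (simp add: seminorm_def sublinear_def)

text \<open>Instead of extending from a line, Hahn-Banach is applied to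
  \<open>lower_shift p e\<close>: a functional below it satisfies
  \<open>f (- e) \<le> - p e\<close>, hence attains \<open>p e\<close> at \<open>e\<close>.\<close>

lemma norming_functional:
  assumes p: "seminorm scl p"
  obtains f where "real_functional f" "\<And>x. f x \<le> p x" "f e = p e"
proof -
  have s: "sublinear p" using p by (rule seminorm_imp_sublinear)
  obtain f where f: "real_functional f" "f \<le> lower_shift p e"
    using Hahn_Banach_sublinear[OF sublinear_lower_shift[OF s]] .
  have le: "f x \<le> p x" for x
    using f(2) lower_shift_bound[OF s, of 0 e x] by (auto simp: le_fun_def intro: order.trans)
  have "f (- e) \<le> - p e"
    using f(2) lower_shift_bound[OF s, of 1 e "- e"]
    by (auto simp: le_fun_def seminorm_zero[OF p] intro: order.trans)
  moreover have "f (- e) = - f e"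
    using f(1) unfolding real_functional_def
    by (metis of_real_minus of_real_1 scale_minus_left scale_one mult_minus1)
  ultimately have "f e = p e" using le[of e] by simp
  with f(1) le show thesis by (intro that)
qed

section \<open>Subspaces meeting every infinite-dimensional subspace\<close>

text \<open>A substitute for finite codimension that needs no dimension count.\<close>

definition large :: "'a set \<Rightarrow> bool" where
  "large V \<longleftrightarrow> subspace V \<and>
     (\<forall>W. subspace W \<longrightarrow> infinite_dimensional scl W \<longrightarrow> infinite_dimensional scl (W \<inter> V))"

lemma large_subspace: "large V \<Longrightarrow> subspace V"
  by (simp add: large_def)

lemma large_UNIV: "large UNIV"
  by (simp add: large_def)

lemma large_Int: "large V \<Longrightarrow> large V' \<Longrightarrow> large (V \<inter> V')"
  unfolding large_def by (metis Int_assoc subspace_inter)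

lemma large_INT: "finite I \<Longrightarrow> (\<And>i. i \<in> I \<Longrightarrow> large (V i)) \<Longrightarrow> large (\<Inter>i\<in>I. V i)"
  by (induction I rule: finite_induct) (auto intro: large_Int large_UNIV)

lemma infinite_dimensional_nonzero:
  assumes "infinite_dimensional scl W" "subspace W"
  obtains x where "x \<in> W" "x \<noteq> 0"
proof -
  have "W \<noteq> span {}" using assms(1) unfolding infinite_dimensional_def by blast
  moreover have "0 \<in> W" using assms(2) by (rule subspace_0)
  ultimately show thesis using that by auto
qed

text \<open>
  The set below is the largest \<open>'k\<close>-subspace inside the kernel of \<open>f\<close>; using it avoids the
  complexification step of the Hahn-Banach theorem.
\<close>

lemma large_kernel:
  assumes f: "real_functional f"
  shows "large {v. \<forall>c. f (scl c v) = 0}" (is "large ?V")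
  unfolding large_def
proof (intro conjI allI impI)
  have add: "f (x + y) = f x + f y" and sc: "f (scl (of_real r) x) = r * f x" for x y r
    using f by (auto simp: real_functional_def)
  have f0: "f 0 = 0" using sc[of 0 0] by simp
  have fsum: "f (sum h A) = (\<Sum>i\<in>A. f (h i))" for h :: "'i \<Rightarrow> 'a" and A
    by (induction A rule: infinite_finite_induct) (auto simp: add f0)
  show "subspace ?V"
    by (auto simp: subspace_def add f0 scale_right_distrib)
  fix W assume W: "subspace W" and inf: "infinite_dimensional scl W"
  show "infinite_dimensional scl (W \<inter> ?V)"
  proof (rule ccontr)
    assume "\<not> infinite_dimensional scl (W \<inter> ?V)"
    then obtain B where B: "finite B" "W \<inter> ?V = span B"
      unfolding infinite_dimensional_def by blast
    define g :: "'a \<Rightarrow> 'k" where "g x = (\<Sum>b\<in>Basis. f (scl b x) *\<^sub>R b)" for x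
    have gadd: "g (x + y) = g x + g y" for x y
      by (simp add: g_def add scale_right_distrib scaleR_add_left sum.distrib)
    have gsc: "g (scl (of_real r) x) = r *\<^sub>R g x" for r x
    proof -
      have "f (scl b (scl (of_real r) x)) = r * f (scl b x)" for b
        using sc[of r "scl b x"] by (simp add: mult.commute)
      then show ?thesis by (simp add: g_def scaleR_right.sum del: scale_scale)
    qed
    have g0: "g 0 = 0" by (simp add: g_def f0)
    have gsum: "g (sum h A) = (\<Sum>i\<in>A. g (h i))" for h :: "'k \<Rightarrow> 'a" and A
      by (induction A rule: infinite_finite_induct) (auto simp: gadd g0)
    have gV: "x \<in> ?V" if "g x = 0" for x
    proof -
      have b: "f (scl b x) = 0" if "b \<in> Basis" for b
      proof -
        have "g x \<bullet> b = f (scl b x)" unfolding g_def using that by (rule inner_sum_left_Basis)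
        then show ?thesis using \<open>g x = 0\<close> by simp
      qed
      have "f (scl c x) = 0" for c
      proof -
        have "scl c x = scl (\<Sum>b\<in>Basis. (c \<bullet> b) *\<^sub>R b) x"
          by (simp add: euclidean_representation)
        also have "\<dots> = (\<Sum>b\<in>Basis. scl (of_real (c \<bullet> b)) (scl b x))"
          by (simp add: scale_sum_left scaleR_conv_of_real)
        finally have "scl c x = (\<Sum>b\<in>Basis. scl (of_real (c \<bullet> b)) (scl b x))" .
        then show ?thesis by (simp add: fsum sc b del: scale_scale)
      qed
      then show ?thesis by simp
    qed
    obtain B' where B': "finite B'" "B' \<subseteq> g ` W"
      "\<forall>y\<in>g ` W. \<exists>r. y = (\<Sum>b\<in>B'. r b *\<^sub>R b)"
      using finite_real_generators[of "g ` W"] by blast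
    have "\<forall>b\<in>B'. \<exists>w. w \<in> W \<and> g w = b" using B'(2) by blast
    then obtain w where w: "\<And>b. b \<in> B' \<Longrightarrow> w b \<in> W \<and> g (w b) = b" by metis
    have "W = span (B \<union> w ` B')"
    proof
      show "W \<subseteq> span (B \<union> w ` B')"
      proof
        fix x assume x: "x \<in> W"
        then obtain r where r: "g x = (\<Sum>b\<in>B'. r b *\<^sub>R b)"
          using B'(3) by blast
        define y where "y = (\<Sum>b\<in>B'. scl (of_real (r b)) (w b))"
        have "g y = g x" by (simp add: y_def gsum gsc r w)
        moreover have "g (x - y) + g y = g x" using gadd[of "x - y" y] by simp
        ultimately have "x - y \<in> ?V" using gV[of "x - y"] by simp
        moreover have "y \<in> W" unfolding y_def
          using w W by (intro subspace_sum subspace_scale) auto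
        ultimately have "x - y \<in> span B" using x W B(2) subspace_diff by blast
        moreover have "y \<in> span (w ` B')" unfolding y_def
          by (intro span_sum span_scale span_base) auto
        ultimately have "(x - y) + y \<in> span (B \<union> w ` B')"
          by (intro span_add) (auto intro: span_mono[THEN subsetD])
        then show "x \<in> span (B \<union> w ` B')" by simp
      qed
      have "B \<subseteq> W" using B(2) span_superset by blast
      then show "span (B \<union> w ` B') \<subseteq> W" using w W by (intro span_minimal) auto
    qed
    moreover have "finite (B \<union> w ` B')" using B(1) B'(1) by simp
    ultimately show False using inf unfolding infinite_dimensional_def by metis
  qed
qed

text \<open>Mazur's argument for basic sequences. Hypothesis \<open>c\<close> bounds the
  coefficients on the unit sphere of \<open>p\<close>, so the sphere has a finite net. Vectors of
  \<open>V\<close> are annihilated by norming functionals of the net, so adding them cannot lower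
  the values of these functionals. A net vector within 1/4 has \<open>p\<close>-value at least 3/4,
  which leaves 1/2 and hence the factor 2.\<close>

lemma large_norming:
  fixes u :: "nat \<Rightarrow> 'a"
  assumes p: "seminorm scl p"
    and c: "\<And>a i. i < N \<Longrightarrow> norm (a i) \<le> c * p (\<Sum>i<N. scl (a i) (u i))"
  shows "\<exists>V. large V \<and> (\<forall>a. \<forall>v\<in>V.
    p (\<Sum>i<N. scl (a i) (u i)) \<le> 2 * p ((\<Sum>i<N. scl (a i) (u i)) + v))"
proof -
  \<comment> \<open>The summand 1 keeps \<open>s\<close> positive even if all \<open>p (u i)\<close>
    vanish; coefficients within \<open>1 / (4 * s)\<close> give vectors within 1/4.\<close>
  define s where "s = (\<Sum>i<N. p (u i)) + 1"
  have s: "s > 0" unfolding s_def using p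
    by (intro add_nonneg_pos sum_nonneg) (auto simp: seminorm_ge_0)
  obtain D where D: "finite D" "cball (0::'k) c \<subseteq> (\<Union>x\<in>D. ball x (1 / (4 * s)))"
    using compact_cball[of "0::'k" c] s unfolding compact_eq_totally_bounded
    by (meson divide_pos_pos mult_pos_pos zero_less_numeral zero_less_one)
  \<comment> \<open>\<open>F\<close> approximates the \<open>p\<close>-unit sphere of the span of \<open>u\<close> up to \<open>1/4\<close>.\<close>
  define F where "F = (\<lambda>a. \<Sum>i<N. scl (a i) (u i)) ` (Pi\<^sub>E {..<N} (\<lambda>_. D))"
  have finF: "finite F" unfolding F_def using D(1) by (intro finite_imageI finite_PiE) auto
  obtain \<phi> where \<phi>: "\<And>e. real_functional (\<phi> e)" "\<And>e x. \<phi> e x \<le> p x" "\<And>e. \<phi> e e = p e"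
  proof -
    have "\<forall>e. \<exists>f. real_functional f \<and> (\<forall>x. f x \<le> p x) \<and> f e = p e"
      using norming_functional[OF p] by metis
    then show thesis using that by metis
  qed
  define V where "V = (\<Inter>e\<in>F. {v. \<forall>c. \<phi> e (scl c v) = 0})"
  have "large V" unfolding V_def using finF \<phi>(1) by (intro large_INT large_kernel)
  moreover have "p (\<Sum>i<N. scl (a i) (u i)) \<le> 2 * p ((\<Sum>i<N. scl (a i) (u i)) + v)"
    if v: "v \<in> V" for a v
  proof (cases "p (\<Sum>i<N. scl (a i) (u i)) = 0")
    case True
    then show ?thesis using p by (simp add: seminorm_ge_0)
  next
    case False
    define x where "x = (\<Sum>i<N. scl (a i) (u i))"
    define r where "r = 1 / p x"
    have px: "p x > 0" using False seminorm_ge_0[OF p, of x] by (simp add: x_def)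
    then have r: "r > 0" by (simp add: r_def)
    define b where "b i = of_real r * a i" for i
    have xb: "scl (of_real r) x = (\<Sum>i<N. scl (b i) (u i))"
      by (simp add: x_def b_def scale_sum_right)
    have pb: "p (\<Sum>i<N. scl (b i) (u i)) = 1"
      unfolding xb[symmetric] using px r by (simp add: seminorm_scale[OF p]) (simp add: r_def)
    have "\<exists>d\<in>D. norm (b i - d) < 1 / (4 * s)" if "i < N" for i
    proof -
      have "b i \<in> cball 0 c" using c[OF that, of b] pb by simp
      then show ?thesis using D(2) by (fastforce simp: dist_norm norm_minus_commute)
    qed
    then obtain d where d: "\<And>i. i < N \<Longrightarrow> d i \<in> D \<and> norm (b i - d i) < 1 / (4 * s)" by metis
    define e where "e = (\<Sum>i<N. scl (d i) (u i))"
    have "e = (\<Sum>i<N. scl (restrict d {..<N} i) (u i))" by (simp add: e_def)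
    then have eF: "e \<in> F" unfolding F_def using d by (intro image_eqI[where x="restrict d {..<N}"]) auto
    have "scl (of_real r) x - e = (\<Sum>i<N. scl (b i - d i) (u i))"
      by (simp add: xb e_def scale_left_diff_distrib sum_subtractf)
    then have "p (scl (of_real r) x - e) \<le> (\<Sum>i<N. norm (b i - d i) * p (u i))"
      using seminorm_sum[OF p] by (simp add: seminorm_scale[OF p, symmetric])
    also have "\<dots> \<le> (\<Sum>i<N. 1 / (4 * s) * p (u i))"
      using d p by (intro sum_mono mult_right_mono) (auto simp: seminorm_ge_0 less_imp_le)
    also have "\<dots> \<le> 1 / (4 * s) * s"
      unfolding sum_distrib_left[symmetric] using s by (intro mult_left_mono) (auto simp: s_def)
    finally have close: "p (scl (of_real r) x - e) \<le> 1/4" using s by simp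
    let ?f = "\<phi> e"
    have fadd: "?f (y + z) = ?f y + ?f z" for y z
      using \<phi>(1) by (simp add: real_functional_def)
    have fsc: "?f (scl (of_real r) y) = r * ?f y" for r y
      using \<phi>(1) by (simp add: real_functional_def)
    have fv: "?f v = 0" using v eF unfolding V_def by (auto dest!: bspec spec[of _ 1])
    have "?f (e - scl (of_real r) x) \<le> 1/4"
      using \<phi>(2)[of e "e - scl (of_real r) x"] close seminorm_minus_commute[OF p, of e] by simp
    moreover have "?f e = ?f (e - scl (of_real r) x) + r * ?f x"
      using fadd[of "e - scl (of_real r) x" "scl (of_real r) x"] fsc by simp
    moreover have "p e \<ge> 3/4"
      using seminorm_triangle_sub[OF p, of "scl (of_real r) x" e] pb close xb by simp
    ultimately have "1/2 \<le> r * ?f x" using \<phi>(3)[of e] by simp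
    also have "?f x = ?f (x + v)" using fv fadd by simp
    also have "r * ?f (x + v) \<le> r * p (x + v)" using r \<phi>(2) by (intro mult_left_mono) auto
    finally have "p x \<le> 2 * p (x + v)" using px by (simp add: r_def field_simps)
    then show ?thesis by (simp add: x_def)
  qed
  ultimately show ?thesis by blast
qed

end

section \<open>Partial sums and coefficients of a finite basic sequence\<close>

context normed_scalars
begin

text \<open>The terms beyond \<open>h\<close> add up to an element of \<open>V\<close>, which
  \<open>low\<close> absorbs as its \<open>v\<close>.\<close>

lemma head_bound:
  assumes p: "seminorm scl p" and V: "subspace V" and mem: "\<And>i. h < i \<Longrightarrow> i < N \<Longrightarrow> u i \<in> V"
    and low: "\<And>a v. v \<in> V \<Longrightarrow> p (\<Sum>i<Suc h. scl (a i) (u i)) \<le> 2 * p ((\<Sum>i<Suc h. scl (a i) (u i)) + v)"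
    and h: "h < N"
  shows "p (\<Sum>i<Suc h. scl (a i) (u i)) \<le> 2 * p (\<Sum>i<N. scl (a i) (u i))"
proof -
  have "(\<Sum>i\<in>{Suc h..<N}. scl (a i) (u i)) \<in> V"
    using mem V by (intro subspace_sum subspace_scale) auto
  moreover have "(\<Sum>i<N. scl (a i) (u i))
      = (\<Sum>i<Suc h. scl (a i) (u i)) + (\<Sum>i\<in>{Suc h..<N}. scl (a i) (u i))"
    using h sum.atLeastLessThan_concat[of 0 "Suc h" N "\<lambda>i. scl (a i) (u i)"]
    by (simp only: lessThan_atLeast0)
  ultimately show ?thesis using low by metis
qed

text \<open>The k-th term is the difference of two consecutive heads, each costing a factor 2. Only
  subspaces with \<open>Suc h < N\<close> occur, so the bound is already available when the subspace
  of the last stage is still to be chosen.\<close>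

lemma coeff_bound:
  assumes p: "seminorm scl p" and unit: "\<And>k. k < N \<Longrightarrow> p (u k) = 1"
    and V: "\<And>h. Suc h < N \<Longrightarrow> subspace (V h)"
    and mem: "\<And>h i. h < i \<Longrightarrow> i < N \<Longrightarrow> u i \<in> V h"
    and low: "\<And>h a v. Suc h < N \<Longrightarrow> v \<in> V h \<Longrightarrow>
      p (\<Sum>i<Suc h. scl (a i) (u i)) \<le> 2 * p ((\<Sum>i<Suc h. scl (a i) (u i)) + v)"
    and k: "k < N"
  shows "norm (a k) \<le> 4 * p (\<Sum>i<N. scl (a i) (u i))"
proof -
  let ?s = "\<lambda>n. \<Sum>i<n. scl (a i) (u i)"
  have head: "p (?s n) \<le> 2 * p (?s N)" if "n \<le> N" for n
  proof -
    have "n = 0 \<or> n = N \<or> (\<exists>h. n = Suc h \<and> Suc h < N)"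
      using that by (cases n) auto
    moreover have "p (?s (Suc h)) \<le> 2 * p (?s N)" if "Suc h < N" for h
      by (rule head_bound[OF p V[OF that]]) (use that mem low in auto)
    ultimately show ?thesis
      using seminorm_ge_0[OF p, of "?s N"] by (auto simp: seminorm_zero[OF p] simp del: sum.lessThan_Suc)
  qed
  have "norm (a k) = p (scl (a k) (u k))" using unit k by (simp add: seminorm_scale[OF p])
  also have "scl (a k) (u k) = ?s (Suc k) - ?s k" by simp
  also have "p \<dots> \<le> p (?s (Suc k)) + p (?s k)" by (rule seminorm_diff[OF p])
  also have "\<dots> \<le> 4 * p (?s N)" using head[of "Suc k"] head[of k] k by linarith
  finally show ?thesis .
qed

end

section \<open>The inductive construction\<close>

text \<open>
  Stage \<open>i\<close> consists of an index \<open>j\<close>, a small vector that \<open>S j\<close> moves close to a target, a basic vector,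
  an approximation of it by a vector with null orbit, and a subspace that has to contain all later
  basic vectors.
\<close>

datatype 'a stage =
  Stage (index: nat) (kick: 'a) (basic: 'a) (smooth: 'a) (room: "'a set")

text \<open>The shift by 5 makes the total perturbation of the basic sequence at most \<open>1/8\<close>.\<close>

definition eps :: "nat \<Rightarrow> real" where
  "eps i = (1/2) ^ (i + 5)"

lemma eps_pos: "eps i > 0"
  by (simp add: eps_def)

text \<open>
  The kick of stage \<open>i\<close> is attached to coordinate \<open>coord_code i\<close> and aims at target \<open>target_code i\<close>.
\<close>

definition coord_code :: "nat \<Rightarrow> nat" where
  "coord_code i = fst (prod_decode i)"

definition target_code :: "nat \<Rightarrow> nat" where
  "target_code i = fst (prod_decode (snd (prod_decode i)))"

lemma coord_code_le: "coord_code i \<le> i"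
  unfolding coord_code_def by (metis le_prod_encode_1 prod.collapse prod_decode_inverse)

text \<open>The third component of the code is padding that makes the stage arbitrarily
  late.\<close>

lemma codes_frequent: "\<exists>i\<ge>r. coord_code i = k \<and> target_code i = l"
proof -
  have "r \<le> prod_encode (k, prod_encode (l, r))"
    by (meson le_prod_encode_2 order.trans)
  then show ?thesis
    by (intro exI[of _ "prod_encode (k, prod_encode (l, r))"])
       (simp add: coord_code_def target_code_def)
qed

text \<open>The hypotheses in pure seminorm form, indexed from 0 and with the subsequence absorbed
  into \<open>S\<close>. The continuous norm is \<open>P 0\<close>; \<open>null_dense\<close> and
  \<open>hit\<close> are the two halves of condition (C).\<close>

locale hypercyclic_data =
  X: normed_scalars sX + Y: normed_scalars sY
  for sX :: "'k::{real_normed_field, euclidean_space} \<Rightarrow> 'a::ab_group_add \<Rightarrow> 'a"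
    and sY :: "'k \<Rightarrow> 'b::ab_group_add \<Rightarrow> 'b" +
  fixes P :: "nat \<Rightarrow> 'a \<Rightarrow> real"
    and Q :: "nat \<Rightarrow> 'b \<Rightarrow> real"
    and S :: "nat \<Rightarrow> 'a \<Rightarrow> 'b"
    and M :: "nat \<Rightarrow> 'a set"
    and yy :: "nat \<Rightarrow> 'b"
  assumes P_seminorm: "seminorm sX (P n)"
    and P_mono: "m \<le> n \<Longrightarrow> P m x \<le> P n x"
    and P_norm: "P 0 x = 0 \<Longrightarrow> x = 0"
    and Q_seminorm: "seminorm sY (Q n)"
    and Q_mono: "m \<le> n \<Longrightarrow> Q m w \<le> Q n w"
    and X_complete: "(\<And>n e. e > 0 \<Longrightarrow> \<exists>N. \<forall>i\<ge>N. \<forall>j\<ge>N. P n (\<xi> i - \<xi> j) < e)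
      \<Longrightarrow> \<exists>l. \<forall>n. (\<lambda>i. P n (\<xi> i - l)) \<longlonglongrightarrow> 0"
    and S_add: "S j (x + x') = S j x + S j x'"
    and S_scale: "S j (sX c x) = sY c (S j x)"
    and S_bounded: "\<exists>m. \<exists>C>0. \<forall>x. Q n (S j x) \<le> C * P m x"
    and null_dense: "e > 0 \<Longrightarrow> \<exists>x'. (\<forall>n. (\<lambda>j. Q n (S j x')) \<longlonglongrightarrow> 0) \<and> P n (x - x') < e"
    and hit: "e > 0 \<Longrightarrow> \<exists>j z. P n z < e \<and> Q m (S j z - w) < e"
    and targets_dense: "e > 0 \<Longrightarrow> \<exists>l. Q n (yy l - w) < e"
    and M_subspace: "X.subspace (M j)"
    and M_infinite: "infinite_dimensional sX (M j)"
    and M_decreasing: "M (Suc j) \<subseteq> M j"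
    and M_bounded: "\<exists>m k. \<exists>C>0. \<forall>j\<ge>k. \<forall>x\<in>M j. Q n (S j x) \<le> C * P m x"
begin

definition null :: "'a \<Rightarrow> bool" where
  "null x \<longleftrightarrow> (\<forall>n. (\<lambda>j. Q n (S j x)) \<longlonglongrightarrow> 0)"

lemma S_zero: "S j 0 = 0"
  using S_scale[of j 0 0] by simp

lemma S_minus: "S j (- x) = - S j x"
  using S_add[of j x "- x"] by (simp add: S_zero add_eq_0_iff)

lemma S_diff: "S j (x - x') = S j x - S j x'"
  using S_add[of j x "- x'"] by (simp add: S_minus)

lemma S_sum: "S j (sum g A) = (\<Sum>i\<in>A. S j (g i))"
  by (induction A rule: infinite_finite_induct) (auto simp: S_add S_zero)

lemmas P_ge_0 = X.seminorm_ge_0[OF P_seminorm]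
lemmas Q_ge_0 = Y.seminorm_ge_0[OF Q_seminorm]

text \<open>One constant and one seminorm serve for finitely many operators;
  \<open>m \<ge> i\<close> ensures that smallness for \<open>P m\<close> includes smallness for
  \<open>P i\<close>.\<close>

lemma S_bounded_finite:
  assumes "finite A"
  shows "\<exists>m\<ge>i. \<exists>C>0. \<forall>h\<in>A. \<forall>x. Q (a h) (S (g h) x) \<le> C * P m x"
  using assms
proof (induction A rule: finite_induct)
  case empty
  show ?case by (auto intro: zero_less_one)
next
  case (insert b A)
  then obtain m C where m: "m \<ge> i" "C > 0" "\<And>h x. h \<in> A \<Longrightarrow> Q (a h) (S (g h) x) \<le> C * P m x" by blast
  obtain m' C' where m': "C' > 0" "\<And>x. Q (a b) (S (g b) x) \<le> C' * P m' x" using S_bounded by blast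
  have 1: "C * P m x \<le> (C + C') * P (max m m') x" "C' * P m' x \<le> (C + C') * P (max m m') x" for x
    using m(2) m'(1) P_mono[of m "max m m'" x] P_mono[of m' "max m m'" x] P_ge_0
    by (auto intro!: mult_mono)
  have "Q (a h) (S (g h) x) \<le> (C + C') * P (max m m') x" if "h \<in> insert b A" for h x
    using that order.trans[OF m(3) 1(1)] order.trans[OF m'(2) 1(2)] by auto
  moreover have "max m m' \<ge> i" "C + C' > 0" using m m' by auto
  ultimately show ?case by blast
qed

text \<open>
  If \<open>Q m w\<close> is not small, then a sufficiently small \<open>z\<close> cannot come close to \<open>w\<close> under one of the
  finitely many \<open>S j\<close> with \<open>j < K\<close>; otherwise \<open>z = 0\<close> works.
\<close>

lemma hit_late:
  assumes e: "e > 0"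
  obtains j z where "j \<ge> K" "null z" "P n z < e" "Q m (S j z - w) < e"
proof -
  have "\<exists>j z. j \<ge> K \<and> P n z < e/2 \<and> Q m (S j z - w) < e/2"
  proof (cases "Q m w < e/2")
    case True
    then show ?thesis
      using e by (intro exI[of _ K] exI[of _ 0])
        (auto simp: S_zero X.seminorm_zero[OF P_seminorm] Y.seminorm_minus[OF Q_seminorm])
  next
    case False
    obtain n' C where n': "n' \<ge> n" "C > 0" "\<And>j x. j < K \<Longrightarrow> Q m (S j x) \<le> C * P n' x"
      using S_bounded_finite[of "{..<K}" n "\<lambda>_. m" "\<lambda>j. j"] by blast
    obtain j z where jz: "P n' z < min (e/4) (e / (4 * C))" "Q m (S j z - w) < min (e/4) (e / (4 * C))"
      using hit[of "min (e/4) (e / (4 * C))" n' m w] e n'(2) by auto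
    have "j \<ge> K"
    proof (rule ccontr)
      assume "\<not> j \<ge> K"
      then have "Q m (S j z) \<le> C * P n' z" using n' by simp
      also have "\<dots> < C * (e / (4 * C))" using jz n'(2) by (intro mult_strict_left_mono) auto
      also have "\<dots> = e/4" using n'(2) by simp
      finally have "Q m w < e/4 + e/4"
        using Y.seminorm_triangle_sub[OF Q_seminorm, of m w "S j z"] jz
          Y.seminorm_minus_commute[OF Q_seminorm, of m w] by simp
      then show False using False by simp
    qed
    moreover have "P n z < e/2" using P_mono[OF n'(1), of z] jz e by simp
    moreover have "Q m (S j z - w) < e/2" using jz e by simp
    ultimately show ?thesis by blast
  qed
  then obtain j z0 where j: "j \<ge> K" "P n z0 < e/2" "Q m (S j z0 - w) < e/2" by blast
  \<comment> \<open>The vector \<open>z0\<close> need not have null orbit. Now that \<open>j\<close>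
    is fixed, continuity of \<open>S j\<close> tells how closely a null-orbit vector must
    approximate it.\<close>
  obtain n' C where n': "n' \<ge> n" "C > 0" "\<And>x. Q m (S j x) \<le> C * P n' x"
    using S_bounded_finite[of "{j}" n "\<lambda>_. m" "\<lambda>j. j"] by blast
  obtain z where z: "null z" "P n' (z0 - z) < min (e/2) (e / (2 * C))"
    using null_dense[of "min (e/2) (e / (2 * C))" n' z0] e n'(2) by (auto simp: null_def)
  have "P n z < e"
    using X.seminorm_triangle_sub[OF P_seminorm, of n z z0] j z P_mono[OF n'(1), of "z0 - z"]
      X.seminorm_minus_commute[OF P_seminorm, of n z z0] by simp
  moreover have "Q m (S j z - w) < e"
  proof -
    have "Q m (S j (z0 - z)) < C * (e / (2 * C))"
      using n'(2) z by (intro le_less_trans[OF n'(3)] mult_strict_left_mono) auto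
    also have "\<dots> = e/2" using n'(2) by simp
    finally have "Q m (S j z0 - S j z) < e/2" by (simp add: S_diff)
    moreover have "Q m (S j z - w) \<le> Q m (S j z0 - w) + Q m (S j z0 - S j z)"
      using Y.seminorm_triangle_sub[OF Q_seminorm, of m "S j z - w" "S j z0 - w"]
        Y.seminorm_minus_commute[OF Q_seminorm, of m "S j z" "S j z0"] by simp
    ultimately show ?thesis using j by simp
  qed
  ultimately show thesis using j z by (intro that)
qed

text \<open>Only the values of \<open>f\<close> below \<open>i\<close> are read, and the new stage
  is a separate argument, as recursive choice requires. Smallness is demanded both of the new
  operator on old vectors and of the old operators on new vectors.\<close>

definition step :: "(nat \<Rightarrow> 'a stage) \<Rightarrow> nat \<Rightarrow> 'a stage \<Rightarrow> bool" where
  "step f i s \<longleftrightarrow>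
     (\<forall>h<i. index (f h) < index s) \<and> null (kick s) \<and> null (smooth s) \<and>
     Q i (S (index s) (kick s) - yy (target_code i)) \<le> eps i \<and>
     (\<forall>h<i. Q i (S (index s) (kick (f h))) \<le> eps i \<and> Q i (S (index s) (smooth (f h))) \<le> eps i) \<and>
     P i (kick s) \<le> eps i \<and> (\<forall>h<i. Q h (S (index (f h)) (kick s)) \<le> eps i) \<and>
     basic s \<in> M (index s) \<and> P 0 (basic s) = 1 \<and> (\<forall>h<i. basic s \<in> room (f h)) \<and>
     P i (smooth s - basic s) \<le> eps i \<and> Q i (S (index s) (smooth s - basic s)) \<le> eps i \<and>
     (\<forall>h<i. Q h (S (index (f h)) (smooth s - basic s)) \<le> eps i) \<and>
     X.large (room s) \<and>
     (\<forall>n\<le>i. \<forall>a. \<forall>v\<in>room s.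
        P n ((\<Sum>k<i. sX (a k) (basic (f k))) + sX (a i) (basic s))
          \<le> 2 * P n ((\<Sum>k<i. sX (a k) (basic (f k))) + sX (a i) (basic s) + v))"

lemma
  assumes "step f i s"
  shows step_index: "h < i \<Longrightarrow> index (f h) < index s"
    and step_null_kick: "null (kick s)"
    and step_null_smooth: "null (smooth s)"
    and step_hit: "Q i (S (index s) (kick s) - yy (target_code i)) \<le> eps i"
    and step_old_kick: "h < i \<Longrightarrow> Q i (S (index s) (kick (f h))) \<le> eps i"
    and step_old_smooth: "h < i \<Longrightarrow> Q i (S (index s) (smooth (f h))) \<le> eps i"
    and step_kick: "P i (kick s) \<le> eps i"
    and step_new_kick: "h < i \<Longrightarrow> Q h (S (index (f h)) (kick s)) \<le> eps i"
    and step_basic: "basic s \<in> M (index s)"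
    and step_unit: "P 0 (basic s) = 1"
    and step_room: "h < i \<Longrightarrow> basic s \<in> room (f h)"
    and step_smooth: "P i (smooth s - basic s) \<le> eps i"
    and step_current_smooth: "Q i (S (index s) (smooth s - basic s)) \<le> eps i"
    and step_new_smooth: "h < i \<Longrightarrow> Q h (S (index (f h)) (smooth s - basic s)) \<le> eps i"
    and step_large: "X.large (room s)"
    and step_low: "n \<le> i \<Longrightarrow> v \<in> room s \<Longrightarrow>
      P n ((\<Sum>k<i. sX (a k) (basic (f k))) + sX (a i) (basic s))
        \<le> 2 * P n ((\<Sum>k<i. sX (a k) (basic (f k))) + sX (a i) (basic s) + v)"
  using assms unfolding step_def by blast+

lemma step_cong: "(\<And>h. h < i \<Longrightarrow> f h = g h) \<Longrightarrow> step f i s = step g i s"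
proof -
  assume eq: "\<And>h. h < i \<Longrightarrow> f h = g h"
  then have "(\<Sum>k<i. sX (a k) (basic (f k))) = (\<Sum>k<i. sX (a k) (basic (g k)))" for a
    by (intro sum.cong) auto
  with eq show ?thesis unfolding step_def by simp
qed

text \<open>The order of choices matters. The old null orbits say how late \<open>j\<close> must be;
  \<open>j\<close> and the kick come together; only then is \<open>M j\<close> known, from which the
  basic vector is taken; its approximation must be good for all operators up to \<open>j\<close>;
  the room depends on all basic vectors so far.\<close>

lemma step_exists:
  assumes f: "\<And>h. h < i \<Longrightarrow> step f h (f h)"
  shows "\<exists>s. step f i s"
proof -
  have null: "null (kick (f h))" "null (smooth (f h))" if "h < i" for h
    using step_null_kick[OF f[OF that]] step_null_smooth[OF f[OF that]] .
  have "\<forall>\<^sub>F j in sequentially. \<forall>h\<in>{..<i}. index (f h) < j \<and>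
      Q i (S j (kick (f h))) < eps i \<and> Q i (S j (smooth (f h))) < eps i"
  proof (intro eventually_ball_finite ballI eventually_conj)
    fix h assume h: "h \<in> {..<i}"
    show "\<forall>\<^sub>F j in sequentially. index (f h) < j" by (rule eventually_gt_at_top)
    show "\<forall>\<^sub>F j in sequentially. Q i (S j (kick (f h))) < eps i"
      using null[of h] h eps_pos[of i] order_tendstoD(2) unfolding null_def by blast
    show "\<forall>\<^sub>F j in sequentially. Q i (S j (smooth (f h))) < eps i"
      using null[of h] h eps_pos[of i] order_tendstoD(2) unfolding null_def by blast
  qed auto
  then obtain K where K: "\<And>j h. j \<ge> K \<Longrightarrow> h < i \<Longrightarrow> index (f h) < j \<and>
      Q i (S j (kick (f h))) < eps i \<and> Q i (S j (smooth (f h))) < eps i"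
    by (auto simp: eventually_sequentially)
  obtain m C where m: "m \<ge> i" "C > 0"
      "\<And>h x. h < i \<Longrightarrow> Q h (S (index (f h)) x) \<le> C * P m x"
    using S_bounded_finite[of "{..<i}" i "\<lambda>h. h" "\<lambda>h. index (f h)"] by blast
  \<comment> \<open>The bound \<open>eps i / C\<close> makes the images of \<open>z\<close> under
    all old operators small; the bound \<open>eps i\<close> serves \<open>P i\<close> and the
    target.\<close>
  obtain j z where j: "j \<ge> K" and z: "null z" "P m z < min (eps i) (eps i / C)"
      "Q i (S j z - yy (target_code i)) < min (eps i) (eps i / C)"
    using hit_late[of "min (eps i) (eps i / C)" K m i "yy (target_code i)"] eps_pos[of i] m(2)
    by auto
  have zQ: "Q h (S (index (f h)) z) \<le> eps i" if "h < i" for h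
  proof -
    have "C * P m z \<le> C * (eps i / C)" using z(2) m(2) by (intro mult_left_mono) auto
    then show ?thesis using m(3)[OF that, of z] m(2) by simp
  qed
  have zP: "P i z \<le> eps i" using P_mono[OF m(1), of z] z(2) by simp
  have "X.large (\<Inter>h\<in>{..<i}. room (f h))"
    using step_large[OF f] by (intro X.large_INT) auto
  then have "infinite_dimensional sX (M j \<inter> (\<Inter>h\<in>{..<i}. room (f h)))"
    "X.subspace (M j \<inter> (\<Inter>h\<in>{..<i}. room (f h)))"
    using M_subspace M_infinite by (auto simp: X.large_def intro: X.subspace_inter)
  then obtain x where "x \<in> M j \<inter> (\<Inter>h\<in>{..<i}. room (f h))" and x0: "x \<noteq> 0"
    by (rule X.infinite_dimensional_nonzero)
  then have x: "x \<in> M j" "\<And>h. h < i \<Longrightarrow> x \<in> room (f h)" by auto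
  define u where "u = sX (of_real (1 / P 0 x)) x"
  have u: "u \<in> M j" "\<And>h. h < i \<Longrightarrow> u \<in> room (f h)"
    unfolding u_def using x M_subspace X.large_subspace[OF step_large[OF f]]
    by (blast intro: X.subspace_scale)+
  have u1: "P 0 u = 1"
    using P_norm[of x] x0 P_ge_0[of 0 x] unfolding u_def
    by (auto simp: seminorm_scale[OF P_seminorm] norm_divide)
  \<comment> \<open>A provisional stage: only its index and basic vector are read, its smooth vector
    and room being placeholders. It lets the old operators and the new one be bounded
    together.\<close>
  define f' where "f' = f(i := Stage j z u u {})"
  obtain m' C' where m': "m' \<ge> i" "C' > 0"
      "\<And>h x. h \<le> i \<Longrightarrow> Q h (S (index (f' h)) x) \<le> C' * P m' x"
    using S_bounded_finite[of "{..i}" i "\<lambda>h. h" "\<lambda>h. index (f' h)"] by blast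
  obtain t where t: "null t" "P m' (u - t) < min (eps i) (eps i / C')"
    using null_dense[of "min (eps i) (eps i / C')" m' u] eps_pos[of i] m'(2) by (auto simp: null_def)
  then have t': "P m' (t - u) < min (eps i) (eps i / C')"
    by (simp add: X.seminorm_minus_commute[OF P_seminorm, of m' t u])
  have tQ: "Q h (S (index (f' h)) (t - u)) \<le> eps i" if "h \<le> i" for h
  proof -
    have "C' * P m' (t - u) \<le> C' * (eps i / C')" using t' m'(2) by (intro mult_left_mono) auto
    then show ?thesis using m'(3)[OF that, of "t - u"] m'(2) by simp
  qed
  have tP: "P i (t - u) \<le> eps i" using P_mono[OF m'(1), of "t - u"] t' by simp
  define b where "b k = basic (f' k)" for k
  have b: "b k = basic (f k)" if "k < i" for k using that by (simp add: b_def f'_def)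
  have bi: "b i = u" by (simp add: b_def f'_def)
  have sumb: "(\<Sum>k<Suc h. sX (a k) (b k)) = (\<Sum>k<h. sX (a k) (basic (f k))) + sX (a h) (b h)"
    if "h \<le> i" for a h
    using that b by simp
  have cb: "norm (a k) \<le> 4 * P 0 (\<Sum>h<Suc i. sX (a h) (b h))" if "k < Suc i" for a k
  proof (rule X.coeff_bound[OF P_seminorm, where V = "\<lambda>h. room (f h)"])
    show "P 0 (b k) = 1" if "k < Suc i" for k
      using that step_unit[OF f, of k] u1 by (cases "k = i") (auto simp: bi b)
    show "X.subspace (room (f h))" if "Suc h < Suc i" for h
      using that by (intro X.large_subspace step_large[OF f]) simp
    show "b k \<in> room (f h)" if "h < k" "k < Suc i" for h k
      using that u(2)[of h] step_room[OF f, of k h] by (cases "k = i") (auto simp: bi b)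
    show "P 0 (\<Sum>i<Suc h. sX (a i) (b i)) \<le> 2 * P 0 ((\<Sum>i<Suc h. sX (a i) (b i)) + v)"
      if "Suc h < Suc i" "v \<in> room (f h)" for h a v
      using step_low[OF f, of h 0 v a] that sumb[of h a] b[of h] by simp
  qed (use that in auto)
  have "\<exists>V. X.large V \<and> (\<forall>a. \<forall>v\<in>V. P n (\<Sum>k<Suc i. sX (a k) (b k))
      \<le> 2 * P n ((\<Sum>k<Suc i. sX (a k) (b k)) + v))" for n
  proof -
    have "norm (a k) \<le> 4 * P n (\<Sum>h<Suc i. sX (a h) (b h))" if "k < Suc i" for a k
      using cb[OF that, of a] P_mono[of 0 n "\<Sum>h<Suc i. sX (a h) (b h)"] by linarith
    then show ?thesis by (rule X.large_norming[OF P_seminorm])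
  qed
  then have "\<forall>n. \<exists>V. X.large V \<and> (\<forall>a. \<forall>v\<in>V. P n (\<Sum>k<Suc i. sX (a k) (b k))
      \<le> 2 * P n ((\<Sum>k<Suc i. sX (a k) (b k)) + v))" by blast
  from choice[OF this] obtain V where V: "\<And>n. X.large (V n)" "\<And>n a v. v \<in> V n \<Longrightarrow>
      P n (\<Sum>k<Suc i. sX (a k) (b k)) \<le> 2 * P n ((\<Sum>k<Suc i. sX (a k) (b k)) + v)" by blast
  \<comment> \<open>Largeness survives finite intersections only, hence the restriction to seminorms
    of index at most \<open>i\<close>.\<close>
  have "X.large (\<Inter>n\<in>{..i}. V n)" using V(1) by (intro X.large_INT) auto
  moreover have "P n ((\<Sum>k<i. sX (a k) (basic (f k))) + sX (a i) u)
          \<le> 2 * P n ((\<Sum>k<i. sX (a k) (basic (f k))) + sX (a i) u + v)"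
    if "n \<le> i" "v \<in> (\<Inter>n\<in>{..i}. V n)" for n a v
    using V(2)[of v n a] that sumb[of i a] bi by auto
  moreover have "Q i (S j (t - u)) \<le> eps i" using tQ[of i] by (simp add: f'_def)
  moreover have "Q h (S (index (f h)) (t - u)) \<le> eps i" if "h < i" for h
    using tQ[of h] that by (simp add: f'_def)
  ultimately have "step f i (Stage j z u t (\<Inter>n\<in>{..i}. V n))"
    unfolding step_def using K[OF j] z zQ zP u u1 t tP by (auto simp: less_imp_le)
  then show ?thesis by blast
qed

lemma stages_exist: "\<exists>f. \<forall>i. step f i (f i)"
  by (rule dependent_wellorder_choice) (use step_cong step_exists in blast)+

end

lemma eps_Suc: "eps (Suc i) = eps i / 2"
  unfolding eps_def by (simp only: add_Suc power_Suc)

lemma sum_eps_le: "(\<Sum>i\<in>{k..<L}. eps i) \<le> 2 * eps k"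
proof (cases "k \<le> L")
  case True
  then have "(\<Sum>i\<in>{k..<L}. eps i) = 2 * eps k - 2 * eps L"
    by (induction rule: dec_induct) (auto simp: eps_Suc)
  then show ?thesis using eps_pos[of L] by simp
qed (use eps_pos[of k] in auto)

lemma eps_tendsto: "eps \<longlonglongrightarrow> 0"
  unfolding eps_def by (rule LIMSEQ_ignore_initial_segment) (rule LIMSEQ_power_zero, simp)

text \<open>The factor \<open>2 * i + 5\<close> is the number of error contributions of size
  \<open>eps i\<close> in \<open>S_G_estimate\<close>; geometric decay beats this linear
  growth.\<close>

lemma eps_linear_tendsto: "(\<lambda>i. c * real (2 * i + 5) * eps i) \<longlonglongrightarrow> 0"
proof -
  have "(\<lambda>i. c / 16 * (real i * (1/2) ^ i) + 5 * c * eps i) \<longlonglongrightarrow> c / 16 * 0 + 5 * c * 0"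
    using powser_times_n_limit_0[of "1/2 :: real"]
    by (intro tendsto_add tendsto_mult_left eps_tendsto) simp
  moreover have "c / 16 * (real i * (1/2) ^ i) + 5 * c * eps i = c * real (2 * i + 5) * eps i" for i
    by (simp add: eps_def power_add field_simps)
  ultimately show ?thesis by simp
qed

section \<open>Expansions along the perturbed basic sequence\<close>

locale hypercyclic_stages = hypercyclic_data sX sY P Q S M yy
  for sX :: "'k::{real_normed_field, euclidean_space} \<Rightarrow> 'a::ab_group_add \<Rightarrow> 'a"
    and sY :: "'k \<Rightarrow> 'b::ab_group_add \<Rightarrow> 'b"
    and P Q S M yy +
  fixes f :: "nat \<Rightarrow> 'a stage"
  assumes steps: "step f i (f i)"
begin

abbreviation (input) "jj i \<equiv> index (f i)"
abbreviation (input) "z i \<equiv> kick (f i)"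
abbreviation (input) "u i \<equiv> basic (f i)"
abbreviation (input) "t i \<equiv> smooth (f i)"

text \<open>
  The perturbed basic vectors are \<open>t k\<close> plus all \<open>z i\<close> with \<open>coord_code i = k\<close>. Grouping the partial sums
  by stage keeps them finite, and is harmless because \<open>coord_code i \<le> i\<close>.
\<close>

definition G :: "(nat \<Rightarrow> 'k) \<Rightarrow> nat \<Rightarrow> 'a" where
  "G a L = (\<Sum>i<L. sX (a i) (t i) + sX (a (coord_code i)) (z i))"

definition H :: "(nat \<Rightarrow> 'k) \<Rightarrow> nat \<Rightarrow> 'a" where
  "H a L = (\<Sum>i<L. sX (a i) (u i))"

lemma index_ge: "i \<le> jj i"
proof -
  have "strict_mono jj"
    using step_index[OF steps] by (simp add: strict_mono_def)
  then show ?thesis by (rule strict_mono_imp_increasing)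
qed

lemma basic_in_M: "h \<le> i \<Longrightarrow> u i \<in> M (jj h)"
proof -
  assume "h \<le> i"
  then have "jj h \<le> jj i"
    using step_index[OF steps, of h i] by (cases "h = i") auto
  then have "M (jj i) \<subseteq> M (jj h)"
    using M_decreasing by (rule lift_Suc_antimono_le[rotated])
  then show ?thesis using step_basic[OF steps, of i] by blast
qed

lemma H_low: "n \<le> h \<Longrightarrow> v \<in> room (f h) \<Longrightarrow>
    P n (\<Sum>i<Suc h. sX (a i) (u i)) \<le> 2 * P n ((\<Sum>i<Suc h. sX (a i) (u i)) + v)"
  using step_low[OF steps, of n h v a] by simp

lemma H_head: "n \<le> h \<Longrightarrow> h < L \<Longrightarrow> P n (H a (Suc h)) \<le> 2 * P n (H a L)"
  unfolding H_def
  by (rule X.head_bound[OF P_seminorm X.large_subspace[OF step_large[OF steps[of h]]]])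
     (use H_low step_room[OF steps] in auto)

lemma H_coeff: "k < L \<Longrightarrow> norm (a k) \<le> 4 * P 0 (H a L)"
  unfolding H_def
  by (rule X.coeff_bound[OF P_seminorm, where V = "\<lambda>h. room (f h)"])
     (use H_low X.large_subspace[OF step_large[OF steps]] step_room[OF steps] step_unit[OF steps] in auto)

definition dev :: "nat \<Rightarrow> nat \<Rightarrow> real" where
  "dev n i = P n (t i - u i) + P n (z i)"

lemma dev_ge_0: "dev n i \<ge> 0"
  by (simp add: dev_def P_ge_0)

lemma dev_le: "n \<le> i \<Longrightarrow> dev n i \<le> 2 * eps i"
  using P_mono[of n i "t i - u i"] P_mono[of n i "z i"]
    step_smooth[OF steps, of i] step_kick[OF steps, of i] by (simp add: dev_def)

lemma sum_dev_le: "n \<le> k \<Longrightarrow> (\<Sum>i\<in>{k..<L}. dev n i) \<le> 4 * eps k"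
proof -
  assume "n \<le> k"
  then have "(\<Sum>i\<in>{k..<L}. dev n i) \<le> (\<Sum>i\<in>{k..<L}. 2 * eps i)"
    by (intro sum_mono dev_le) auto
  also have "\<dots> \<le> 4 * eps k"
    using sum_eps_le[of k L] by (simp add: sum_distrib_left[symmetric])
  finally show ?thesis .
qed

text \<open>Stages before \<open>n\<close> are not controlled in \<open>P n\<close>, so their
  deviations are kept as they are; the later ones sum to at most
  \<open>4 * eps 0 = 1/8\<close>.\<close>

definition dev_total :: "nat \<Rightarrow> real" where
  "dev_total n = (\<Sum>i<n. dev n i) + 1/8"

lemma dev_total_pos: "dev_total n > 0"
  unfolding dev_total_def by (intro add_nonneg_pos sum_nonneg dev_ge_0) auto

lemma sum_dev_le_total: "(\<Sum>i<L. dev n i) \<le> dev_total n"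
proof -
  have "(\<Sum>i<L. dev n i) \<le> (\<Sum>i<n + L. dev n i)"
    by (intro sum_mono2) (auto simp: dev_ge_0)
  also have "\<dots> = (\<Sum>i<n. dev n i) + (\<Sum>i\<in>{n..<n + L}. dev n i)"
    using sum.atLeastLessThan_concat[of 0 n "n + L" "dev n"] by (simp add: lessThan_atLeast0)
  also have "(\<Sum>i\<in>{n..<n + L}. dev n i) \<le> 4 * eps n" by (rule sum_dev_le) simp
  also have "4 * eps n \<le> 4 * (1/2) ^ 5"
    unfolding eps_def by (intro mult_left_mono power_decreasing) auto
  also have "\<dots> = 1/8" by (simp add: power_divide)
  finally show ?thesis by (simp add: dev_total_def)
qed

text \<open>Since \<open>coord_code i \<le> i\<close>, bounds on the first \<open>L\<close>
  coefficients also cover those of the kicks.\<close>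

lemma G_minus_H:
  assumes A: "\<And>i. i < L \<Longrightarrow> norm (a i) \<le> A" and "k \<le> L"
  shows "P n ((G a L - G a k) - (H a L - H a k)) \<le> A * (\<Sum>i\<in>{k..<L}. dev n i)"
proof -
  have "(G a L - G a k) - (H a L - H a k)
      = (\<Sum>i\<in>{k..<L}. sX (a i) (t i - u i) + sX (a (coord_code i)) (z i))"
    using \<open>k \<le> L\<close> unfolding G_def H_def
    by (simp add: lessThan_atLeast0 sum_diff_nat_ivl sum_subtractf[symmetric]
        X.scale_right_diff_distrib algebra_simps)
  also have "P n \<dots> \<le> (\<Sum>i\<in>{k..<L}. P n (sX (a i) (t i - u i) + sX (a (coord_code i)) (z i)))"
    by (rule X.seminorm_sum[OF P_seminorm])
  also have "\<dots> \<le> (\<Sum>i\<in>{k..<L}. A * dev n i)"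
  proof (rule sum_mono)
    fix i assume i: "i \<in> {k..<L}"
    have "P n (sX (a i) (t i - u i) + sX (a (coord_code i)) (z i))
        \<le> norm (a i) * P n (t i - u i) + norm (a (coord_code i)) * P n (z i)"
      using seminorm_add[OF P_seminorm] by (simp add: seminorm_scale[OF P_seminorm, symmetric])
    also have "\<dots> \<le> A * P n (t i - u i) + A * P n (z i)"
      using i coord_code_le[of i] by (intro add_mono mult_right_mono A P_ge_0) auto
    finally show "P n (sX (a i) (t i - u i) + sX (a (coord_code i)) (z i)) \<le> A * dev n i"
      by (simp add: dev_def algebra_simps)
  qed
  finally show ?thesis by (simp add: sum_distrib_left)
qed

lemma G_minus_H_le:
  "P n (G a L - H a L) \<le> 4 * P 0 (H a L) * dev_total n"
proof -
  have "P n (G a L - H a L) \<le> 4 * P 0 (H a L) * (\<Sum>i<L. dev n i)"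
    using G_minus_H[of L a "4 * P 0 (H a L)" 0 n] H_coeff
    by (simp add: G_def[of _ 0] H_def[of _ 0] lessThan_atLeast0)
  also have "\<dots> \<le> 4 * P 0 (H a L) * dev_total n"
    using sum_dev_le_total P_ge_0 by (intro mult_left_mono) auto
  finally show ?thesis .
qed

text \<open>Here \<open>dev_total 0 = 1/8\<close>, so the difference is at most half of
  \<open>P 0 (H a L)\<close> and can be absorbed.\<close>

lemma H_le_G_0: "P 0 (H a L) \<le> 2 * P 0 (G a L)"
  using G_minus_H_le[of 0 a L] X.seminorm_triangle_sub[OF P_seminorm, of 0 "H a L" "G a L"]
    X.seminorm_minus_commute[OF P_seminorm, of 0 "H a L" "G a L"]
  by (simp add: dev_total_def)

lemma G_coeff: "k < L \<Longrightarrow> norm (a k) \<le> 8 * P 0 (G a L)"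
  using H_coeff[of k L a] H_le_G_0[of a L] by simp

lemma H_le_G: "P n (H a L) \<le> (1 + 8 * dev_total n) * P n (G a L)"
proof -
  have "P n (H a L) \<le> P n (G a L) + P n (G a L - H a L)"
    using X.seminorm_triangle_sub[OF P_seminorm, of n "H a L" "G a L"]
      X.seminorm_minus_commute[OF P_seminorm, of n "H a L" "G a L"] by simp
  also have "P n (G a L - H a L) \<le> 4 * P 0 (H a L) * dev_total n" by (rule G_minus_H_le)
  also have "\<dots> \<le> 4 * (2 * P n (G a L)) * dev_total n"
    using H_le_G_0[of a L] P_mono[of 0 n "G a L"] dev_total_pos[of n]
    by (intro mult_right_mono mult_left_mono) auto
  finally show ?thesis by (simp add: algebra_simps)
qed

lemma G_le_H: "P n (G a L) \<le> (1 + 4 * dev_total n) * P n (H a L)"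
proof -
  have "P n (G a L) \<le> P n (H a L) + P n (G a L - H a L)"
    by (rule X.seminorm_triangle_sub[OF P_seminorm])
  also have "P n (G a L - H a L) \<le> 4 * P 0 (H a L) * dev_total n" by (rule G_minus_H_le)
  also have "\<dots> \<le> 4 * P n (H a L) * dev_total n"
    using P_mono[of 0 n "H a L"] dev_total_pos[of n] by (intro mult_right_mono mult_left_mono) auto
  finally show ?thesis by (simp add: algebra_simps)
qed

definition basis_const :: "nat \<Rightarrow> real" where
  "basis_const n = 2 * (1 + 4 * dev_total n) * (1 + 8 * dev_total n)"

lemma basis_const_pos: "basis_const n > 0"
  using dev_total_pos[of n] by (simp add: basis_const_def)

text \<open>A detour through \<open>H\<close>: the three factors of \<open>basis_const\<close> come
  from \<open>G_le_H\<close>, \<open>H_head\<close> and \<open>H_le_G\<close>. The last stage in the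
  head is \<open>L - 1\<close>, whence \<open>n < L\<close>.\<close>

lemma G_le_G:
  assumes "n < L" "L \<le> L'"
  shows "P n (G a L) \<le> basis_const n * P n (G a L')"
proof -
  obtain h where h: "L = Suc h" using assms by (cases L) auto
  have "P n (G a L) \<le> (1 + 4 * dev_total n) * P n (H a L)" by (rule G_le_H)
  also have "\<dots> \<le> (1 + 4 * dev_total n) * (2 * P n (H a L'))"
    unfolding h using assms h dev_total_pos[of n] by (intro mult_left_mono H_head) auto
  also have "\<dots> \<le> (1 + 4 * dev_total n) * (2 * ((1 + 8 * dev_total n) * P n (G a L')))"
    using dev_total_pos[of n] by (intro mult_left_mono H_le_G) auto
  finally show ?thesis by (simp only: basis_const_def mult_ac)
qed

lemma G_add: "G (\<lambda>i. a i + b i) L = G a L + G b L"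
  by (simp add: G_def X.scale_left_distrib sum.distrib[symmetric] algebra_simps)

lemma G_scale: "G (\<lambda>i. c * a i) L = sX c (G a L)"
  by (simp add: G_def X.scale_sum_right X.scale_right_distrib)

lemma G_diff: "G (\<lambda>i. a i - b i) L = G a L - G b L"
  using G_add[of "\<lambda>i. a i - b i" b L] by (simp add: eq_diff_eq)

lemma G_tendsto_0:
  assumes "\<And>k. (\<lambda>s. b s k) \<longlonglongrightarrow> 0"
  shows "(\<lambda>s. P n (G (b s) L)) \<longlonglongrightarrow> 0"
proof (rule Lim_null_comparison)
  have "P n (G b' L) \<le> (\<Sum>i<L. norm (b' i) * P n (t i) + norm (b' (coord_code i)) * P n (z i))" for b'
  proof -
    have "P n (G b' L) \<le> (\<Sum>i<L. P n (sX (b' i) (t i) + sX (b' (coord_code i)) (z i)))"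
      unfolding G_def by (rule X.seminorm_sum[OF P_seminorm])
    also have "\<dots> \<le> (\<Sum>i<L. norm (b' i) * P n (t i) + norm (b' (coord_code i)) * P n (z i))"
      using seminorm_add[OF P_seminorm]
      by (intro sum_mono) (simp add: seminorm_scale[OF P_seminorm, symmetric])
    finally show ?thesis .
  qed
  then show "\<forall>\<^sub>F s in sequentially. norm (P n (G (b s) L))
      \<le> (\<Sum>i<L. norm (b s i) * P n (t i) + norm (b s (coord_code i)) * P n (z i))"
    by (simp add: P_ge_0)
  have "(\<lambda>s. \<Sum>i<L. norm (b s i) * P n (t i) + norm (b s (coord_code i)) * P n (z i))
      \<longlonglongrightarrow> (\<Sum>i<L. 0 * P n (t i) + 0 * P n (z i))"
    by (intro tendsto_sum tendsto_add tendsto_mult_right tendsto_norm_zero assms)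
  then show "(\<lambda>s. \<Sum>i<L. norm (b s i) * P n (t i) + norm (b s (coord_code i)) * P n (z i))
      \<longlonglongrightarrow> 0" by simp
qed

lemma P_tendsto:
  assumes "(\<lambda>s. P n (x - g s)) \<longlonglongrightarrow> 0"
  shows "(\<lambda>s. P n (g s)) \<longlonglongrightarrow> P n x"
proof (rule Lim_transform2[where f = "\<lambda>_. P n x"])
  show "(\<lambda>s. P n x - P n (g s)) \<longlonglongrightarrow> 0"
  proof (rule Lim_null_comparison[OF _ assms])
    have "\<bar>P n x - P n (g s)\<bar> \<le> P n (x - g s)" for s
      using X.seminorm_triangle_sub[OF P_seminorm, of n x "g s"]
        X.seminorm_triangle_sub[OF P_seminorm, of n "g s" x]
        X.seminorm_minus_commute[OF P_seminorm, of n x "g s"] by linarith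
    then show "\<forall>\<^sub>F s in sequentially. norm (P n x - P n (g s)) \<le> P n (x - g s)" by simp
  qed
qed simp

definition expands :: "'a \<Rightarrow> (nat \<Rightarrow> 'k) \<Rightarrow> bool" where
  "expands x a \<longleftrightarrow> (\<forall>n. (\<lambda>L. P n (x - G a L)) \<longlonglongrightarrow> 0)"

lemma expands_add:
  assumes "expands x a" "expands y b"
  shows "expands (x + y) (\<lambda>i. a i + b i)"
  unfolding expands_def
proof
  fix n
  show "(\<lambda>L. P n (x + y - G (\<lambda>i. a i + b i) L)) \<longlonglongrightarrow> 0"
  proof (rule Lim_null_comparison)
    have "P n (x + y - G (\<lambda>i. a i + b i) L) \<le> P n (x - G a L) + P n (y - G b L)" for L
      using seminorm_add[OF P_seminorm, of n "x - G a L" "y - G b L"] by (simp add: G_add algebra_simps)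
    then show "\<forall>\<^sub>F L in sequentially. norm (P n (x + y - G (\<lambda>i. a i + b i) L))
        \<le> P n (x - G a L) + P n (y - G b L)" by (simp add: P_ge_0)
    show "(\<lambda>L. P n (x - G a L) + P n (y - G b L)) \<longlonglongrightarrow> 0"
      using assms by (intro tendsto_add_zero) (auto simp: expands_def)
  qed
qed

lemma expands_scale:
  assumes "expands x a"
  shows "expands (sX c x) (\<lambda>i. c * a i)"
  unfolding expands_def
proof
  fix n
  have "(\<lambda>L. norm c * P n (x - G a L)) \<longlonglongrightarrow> norm c * 0"
    using assms by (intro tendsto_mult_left) (auto simp: expands_def)
  then show "(\<lambda>L. P n (sX c x - G (\<lambda>i. c * a i) L)) \<longlonglongrightarrow> 0"
    by (simp add: G_scale seminorm_scale[OF P_seminorm] flip: X.scale_right_diff_distrib)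
qed

lemma expands_diff:
  assumes "expands x a" "expands y b"
  shows "expands (x - y) (\<lambda>i. a i - b i)"
  using expands_add[OF assms(1) expands_scale[OF assms(2), of "-1"]] by simp

lemma expands_0: "expands 0 (\<lambda>_. 0)"
  by (simp add: expands_def G_def X.seminorm_zero[OF P_seminorm])

lemma expands_sum:
  "finite F \<Longrightarrow> (\<And>k. k \<in> F \<Longrightarrow> expands (x k) (a k)) \<Longrightarrow>
    expands (\<Sum>k\<in>F. x k) (\<lambda>i. \<Sum>k\<in>F. a k i)"
  by (induction F rule: finite_induct) (auto simp: expands_0 expands_add)

lemma expands_tendsto: "expands x a \<Longrightarrow> (\<lambda>L. P n (G a L)) \<longlonglongrightarrow> P n x"
  by (rule P_tendsto) (simp add: expands_def)

text \<open>Applied to differences, this gives uniqueness of the coefficients and their continuity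
  in \<open>x\<close>.\<close>

lemma expands_coeff:
  assumes "expands x a"
  shows "norm (a k) \<le> 8 * P 0 x"
proof (rule LIMSEQ_le_const)
  show "(\<lambda>L. 8 * P 0 (G a L)) \<longlonglongrightarrow> 8 * P 0 x"
    by (intro tendsto_mult_left expands_tendsto assms)
  show "\<exists>N. \<forall>L\<ge>N. norm (a k) \<le> 8 * P 0 (G a L)"
    using G_coeff by (intro exI[of _ "Suc k"]) auto
qed

lemma expands_partial:
  assumes "expands x a" "n < L"
  shows "P n (G a L) \<le> basis_const n * P n x"
proof (rule LIMSEQ_le_const)
  show "(\<lambda>L'. basis_const n * P n (G a L')) \<longlonglongrightarrow> basis_const n * P n x"
    by (intro tendsto_mult_left expands_tendsto assms)
  show "\<exists>N. \<forall>L'\<ge>N. P n (G a L) \<le> basis_const n * P n (G a L')"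
    using G_le_G assms by blast
qed

lemma expands_nonzero:
  assumes "expands x a" "x \<noteq> 0"
  obtains k where "a k \<noteq> 0"
proof (cases "\<forall>k. a k = 0")
  case True
  then have "G a L = 0" for L by (simp add: G_def)
  then have "P 0 x = 0"
    using expands_tendsto[OF assms(1), of 0] by (simp add: X.seminorm_zero[OF P_seminorm] LIMSEQ_const_iff)
  then show thesis using P_norm assms by blast
qed (use that in blast)

text \<open>Even for finitely supported \<open>a\<close> the sums \<open>G a L\<close> need not
  stabilise, as each coordinate receives kicks at infinitely many stages. The sums
  \<open>H a L\<close> do stabilise, so only summable deviations remain.\<close>

lemma G_Cauchy:
  assumes a: "\<And>i. norm (a i) \<le> A" and fin: "\<And>i. i \<ge> N0 \<Longrightarrow> a i = 0" and e: "e > 0"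
  shows "\<exists>N. \<forall>i\<ge>N. \<forall>j\<ge>N. P n (G a i - G a j) < e"
proof -
  have A0: "A \<ge> 0" using order.trans[OF norm_ge_zero a] .
  have "(\<lambda>i. A * 4 * eps i) \<longlonglongrightarrow> A * 4 * 0" by (intro tendsto_mult_left eps_tendsto)
  then have "\<forall>\<^sub>F i in sequentially. A * 4 * eps i < e" using e by (intro order_tendstoD(2)) auto
  then obtain N1 where N1: "\<And>i. i \<ge> N1 \<Longrightarrow> A * 4 * eps i < e" by (auto simp: eventually_sequentially)
  define N where "N = max (max N0 N1) n"
  have le: "P n (G a j - G a i) < e" if "i \<ge> N" "j \<ge> i" for i j
  proof -
    have "H a j - H a i = (\<Sum>k\<in>{i..<j}. sX (a k) (u k))"
      using that by (simp add: H_def lessThan_atLeast0 sum_diff_nat_ivl)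
    also have "\<dots> = 0" using fin that by (intro sum.neutral) (auto simp: N_def)
    finally have "P n (G a j - G a i) \<le> A * (\<Sum>k\<in>{i..<j}. dev n k)"
      using G_minus_H[of j a A i n] a that by simp
    also have "\<dots> \<le> A * (4 * eps i)"
      using that A0 by (intro mult_left_mono sum_dev_le) (auto simp: N_def)
    also have "\<dots> < e" using N1[of i] that by (simp add: N_def mult_ac)
    finally show ?thesis .
  qed
  have "P n (G a i - G a j) < e" if "i \<ge> N" "j \<ge> N" for i j
    using le[of i j] le[of j i] that X.seminorm_minus_commute[OF P_seminorm, of n "G a i" "G a j"]
    by (cases "i \<le> j") auto
  then show ?thesis by blast
qed

lemma expands_exists:
  assumes fin: "\<And>i. i \<ge> N0 \<Longrightarrow> a i = 0"
  shows "\<exists>x. expands x a"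
proof -
  have "norm (a i) \<le> (\<Sum>i<N0. norm (a i))" for i
  proof (cases "i < N0")
    case True
    then show ?thesis by (intro member_le_sum) auto
  qed (use fin in \<open>auto intro: sum_nonneg\<close>)
  then have "\<exists>l. \<forall>n. (\<lambda>i. P n (G a i - l)) \<longlonglongrightarrow> 0"
    by (intro X_complete G_Cauchy fin)
  then show ?thesis
    by (auto simp: expands_def X.seminorm_minus_commute[OF P_seminorm])
qed

section \<open>The space of all expansions\<close>

definition expansions :: "'a set" where
  "expansions = {x. \<exists>a. expands x a}"

lemma expansions_subspace: "X.subspace expansions"
  unfolding X.subspace_def expansions_def using expands_0 expands_add expands_scale by blast

lemma expansions_infinite_dimensional: "infinite_dimensional sX expansions"
  unfolding infinite_dimensional_def
proof
  assume "\<exists>B. finite B \<and> expansions = X.span B"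
  then obtain B where B: "finite B" "expansions = X.span B" by blast
  have "\<exists>x. expands x (\<lambda>i. if i = k then 1 else 0)" for k
    by (rule expands_exists[of "Suc k"]) auto
  then obtain e where e: "\<And>k. expands (e k) (\<lambda>i. if i = k then 1 else 0)" by metis
  have comb: "c k = 0" if "(\<Sum>k<N. sX (c k) (e k)) = 0" "k < N" for c k N
  proof -
    have "expands (\<Sum>k<N. sX (c k) (e k)) (\<lambda>i. \<Sum>k<N. c k * (if i = k then 1 else 0))"
      by (intro expands_sum expands_scale e) auto
    from expands_coeff[OF this, of k] that show ?thesis
      by (simp add: X.seminorm_zero[OF P_seminorm] if_distrib cong: if_cong)
  qed
  have inj: "inj e"
  proof (rule injI, rule ccontr)
    fix k l assume kl: "e k = e l" "k \<noteq> l"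
    have "expands (e k - e l) (\<lambda>i. (if i = k then 1 else 0) - (if i = l then 1 else 0))"
      by (intro expands_diff e)
    from expands_coeff[OF this, of k] kl show False by (simp add: X.seminorm_zero[OF P_seminorm])
  qed
  have "X.independent (e ` {..<Suc (card B)})"
  proof (rule X.independent_if_scalars_zero)
    fix c x assume s: "(\<Sum>x\<in>e ` {..<Suc (card B)}. sX (c x) x) = 0" and x: "x \<in> e ` {..<Suc (card B)}"
    have "(\<Sum>k<Suc (card B). sX (c (e k)) (e k)) = 0"
      using s inj by (subst (asm) sum.reindex) (auto intro: inj_on_subset)
    then show "c x = 0" using comb[of "\<lambda>k. c (e k)"] x by blast
  qed simp
  moreover have "e ` {..<Suc (card B)} \<subseteq> X.span B"
    using e B(2) by (auto simp: expansions_def)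
  ultimately have "card (e ` {..<Suc (card B)}) \<le> card B"
    using X.independent_span_bound[OF B(1)] by blast
  then show False using card_image[OF inj_on_subset[OF inj subset_UNIV]] by simp
qed

text \<open>Coefficients of approximants converge by \<open>expands_coeff\<close>, and
  \<open>expands_partial\<close> bounds the error of the partial sums uniformly in \<open>L\<close>,
  so the limits in \<open>s\<close> and \<open>L\<close> can be interchanged.\<close>

lemma expansions_closed:
  assumes x: "\<And>n e. e > 0 \<Longrightarrow> \<exists>g\<in>expansions. P n (x - g) < e"
  shows "x \<in> expansions"
proof -
  define r :: "nat \<Rightarrow> real" where "r s = (1/2) ^ s" for s
  have r0: "r \<longlonglongrightarrow> 0" unfolding r_def by (rule LIMSEQ_power_zero) simp
  have rpos: "r s > 0" for s by (simp add: r_def)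
  have "\<exists>g a. expands g a \<and> P s (x - g) < r s" for s
    using x[OF rpos] by (auto simp: expansions_def)
  then obtain g a where g: "\<And>s. expands (g s) (a s)" "\<And>s. P s (x - g s) < r s" by metis
  have gx: "P n (x - g s) < r s" if "n \<le> s" for n s
    using P_mono[OF that, of "x - g s"] g(2)[of s] by simp
  have gg: "P n (g s - g s') < r s + r s'" if "n \<le> s" "n \<le> s'" for n s s'
    using gx[OF that(1)] gx[OF that(2)] X.seminorm_diff[OF P_seminorm, of n "x - g s'" "x - g s"] by simp
  have "\<exists>l. (\<lambda>s. a s k) \<longlonglongrightarrow> l" for k
  proof -
    have "Cauchy (\<lambda>s. a s k)"
    proof (rule metric_CauchyI)
      fix e :: real assume e: "e > 0"
      then have "\<forall>\<^sub>F s in sequentially. r s < e / 16" using r0 by (intro order_tendstoD(2)) auto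
      then obtain N where N: "\<And>s. s \<ge> N \<Longrightarrow> r s < e / 16" by (auto simp: eventually_sequentially)
      have "dist (a s k) (a s' k) < e" if "s \<ge> N" "s' \<ge> N" for s s'
        using expands_coeff[OF expands_diff[OF g(1)[of s] g(1)[of s']], of k]
          gg[of 0 s s'] N[OF that(1)] N[OF that(2)] by (simp add: dist_norm)
      then show "\<exists>N. \<forall>s\<ge>N. \<forall>s'\<ge>N. dist (a s k) (a s' k) < e" by blast
    qed
    then show ?thesis by (simp add: Cauchy_convergent_iff convergent_def)
  qed
  then obtain \<alpha> where \<alpha>: "\<And>k. (\<lambda>s. a s k) \<longlonglongrightarrow> \<alpha> k" by metis
  have lim: "P n (G (a s) L - G \<alpha> L) \<le> basis_const n * r s" if "n \<le> s" "n < L" for n s L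
  proof (rule LIMSEQ_le)
    have "(\<lambda>s'. P n (G (\<lambda>k. \<alpha> k - a s' k) L)) \<longlonglongrightarrow> 0"
      using tendsto_diff[OF tendsto_const \<alpha>] by (intro G_tendsto_0) (metis diff_self)
    then show "(\<lambda>s'. P n (G (a s) L - G (a s') L)) \<longlonglongrightarrow> P n (G (a s) L - G \<alpha> L)"
      by (intro P_tendsto) (simp add: G_diff X.seminorm_minus_commute[OF P_seminorm])
    have "(\<lambda>s'. basis_const n * (r s + r s')) \<longlonglongrightarrow> basis_const n * (r s + 0)"
      by (intro tendsto_mult_left tendsto_add r0 tendsto_const)
    then show "(\<lambda>s'. basis_const n * (r s + r s')) \<longlonglongrightarrow> basis_const n * r s" by simp
    have "P n (G (a s) L - G (a s') L) \<le> basis_const n * (r s + r s')" if "s' \<ge> n" for s'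
    proof -
      have "P n (G (a s) L - G (a s') L) \<le> basis_const n * P n (g s - g s')"
        using expands_partial[OF expands_diff[OF g(1)[of s] g(1)[of s']] \<open>n < L\<close>] by (simp add: G_diff)
      also have "\<dots> \<le> basis_const n * (r s + r s')"
        using gg[OF \<open>n \<le> s\<close> that] basis_const_pos[of n] by (intro mult_left_mono) auto
      finally show ?thesis .
    qed
    then show "\<exists>N. \<forall>s'\<ge>N. P n (G (a s) L - G (a s') L) \<le> basis_const n * (r s + r s')" by blast
  qed
  have "(\<lambda>L. P n (x - G \<alpha> L)) \<longlonglongrightarrow> 0" for n
  proof (rule LIMSEQ_I)
    fix e :: real assume e: "e > 0"
    have "(\<lambda>s. (1 + basis_const n) * r s) \<longlonglongrightarrow> (1 + basis_const n) * 0" by (intro tendsto_mult_left r0)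
    then have "\<forall>\<^sub>F s in sequentially. (1 + basis_const n) * r s < e/2" using e by (intro order_tendstoD(2)) auto
    then obtain s where s: "s \<ge> n" "(1 + basis_const n) * r s < e/2"
      unfolding eventually_sequentially by (metis nle_le)
    have "\<forall>\<^sub>F L in sequentially. P n (g s - G (a s) L) < e/2"
      using g(1)[of s] e by (intro order_tendstoD(2)[of _ 0]) (auto simp: expands_def)
    then obtain N where N: "\<And>L. L \<ge> N \<Longrightarrow> P n (g s - G (a s) L) < e/2"
      by (auto simp: eventually_sequentially)
    have "norm (P n (x - G \<alpha> L) - 0) < e" if "L \<ge> max N (Suc n)" for L
    proof -
      have "P n (x - G \<alpha> L) \<le> P n (x - g s) + P n ((g s - G (a s) L) + (G (a s) L - G \<alpha> L))"
        using seminorm_add[OF P_seminorm, of n "x - g s" "(g s - G (a s) L) + (G (a s) L - G \<alpha> L)"]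
        by simp
      also have "\<dots> \<le> P n (x - g s) + (P n (g s - G (a s) L) + P n (G (a s) L - G \<alpha> L))"
        using seminorm_add[OF P_seminorm] by (intro add_left_mono)
      also have "\<dots> < r s + (e/2 + basis_const n * r s)"
        using gx[OF s(1)] N[of L] lim[OF s(1), of L] that by (intro add_strict_mono add_less_le_mono) auto
      also have "\<dots> < e" using s(2) by (simp add: algebra_simps)
      finally show ?thesis using P_ge_0 by simp
    qed
    then show "\<exists>no. \<forall>L\<ge>no. norm (P n (x - G \<alpha> L) - 0) < e" by blast
  qed
  then show ?thesis unfolding expansions_def expands_def by blast
qed

end

section \<open>Orbits of the expansions\<close>

context hypercyclic_stages
begin

lemma sum_dominated:
  assumes A: "\<And>h. norm (c h) \<le> A" and le: "\<And>h. h \<in> I \<Longrightarrow> Q n (g h) \<le> \<delta> h"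
  shows "Q n (\<Sum>h\<in>I. sY (c h) (g h)) \<le> A * (\<Sum>h\<in>I. \<delta> h)"
proof -
  have "A \<ge> 0" using order.trans[OF norm_ge_zero A] .
  have "Q n (\<Sum>h\<in>I. sY (c h) (g h)) \<le> (\<Sum>h\<in>I. Q n (sY (c h) (g h)))"
    by (rule Y.seminorm_sum[OF Q_seminorm])
  also have "\<dots> \<le> (\<Sum>h\<in>I. A * \<delta> h)"
    using A le Q_ge_0 \<open>A \<ge> 0\<close> by (intro sum_mono) (auto simp: seminorm_scale[OF Q_seminorm] intro!: mult_mono)
  finally show ?thesis by (simp add: sum_distrib_left)
qed

lemma G_split:
  assumes "i < L"
  shows "G a L = G a i + ((H a L - H a i) + (\<Sum>h\<in>{i..<L}. sX (a h) (t h - u h))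
    + (sX (a (coord_code i)) (z i) + (\<Sum>h\<in>{Suc i..<L}. sX (a (coord_code h)) (z h))))"
proof -
  have "H a L - H a i + (\<Sum>h\<in>{i..<L}. sX (a h) (t h - u h)) = (\<Sum>h\<in>{i..<L}. sX (a h) (t h))"
    using assms by (simp add: H_def lessThan_atLeast0 sum_diff_nat_ivl sum_subtractf
        X.scale_right_diff_distrib)
  moreover have "sX (a (coord_code i)) (z i) + (\<Sum>h\<in>{Suc i..<L}. sX (a (coord_code h)) (z h))
      = (\<Sum>h\<in>{i..<L}. sX (a (coord_code h)) (z h))"
    using assms by (simp add: sum.atLeast_Suc_lessThan)
  moreover have "G a L = G a i + ((\<Sum>h\<in>{i..<L}. sX (a h) (t h)) + (\<Sum>h\<in>{i..<L}. sX (a (coord_code h)) (z h)))"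
    using assms sum.atLeastLessThan_concat[of 0 i L "\<lambda>h. sX (a h) (t h) + sX (a (coord_code h)) (z h)"]
    by (simp add: G_def lessThan_atLeast0 sum.distrib[symmetric])
  ultimately show ?thesis by simp
qed

text \<open>In units of \<open>A * eps i\<close>: the old smooth vectors and kicks contribute
  \<open>2 * i\<close>, the differences \<open>t h - u h\<close> from stage \<open>i\<close> on 2,
  the inexact hit 1, and the later kicks 2. The basic tail is left as \<delta>.\<close>

lemma S_G_estimate:
  assumes A: "\<And>h. norm (a h) \<le> A" and n: "n \<le> i" and L: "i < L"
    and tail: "Q n (S (jj i) (H a L - H a i)) \<le> \<delta>"
  shows "Q n (S (jj i) (G a L) - sY (a (coord_code i)) (yy (target_code i)))
    \<le> A * real (2 * i + 5) * eps i + \<delta>"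
proof -
  let ?S = "S (jj i)"
  have A0: "A \<ge> 0" using order.trans[OF norm_ge_zero A] .
  have Qn: "Q n w \<le> \<delta>'" if "Q i w \<le> \<delta>'" for w \<delta>'
    using Q_mono[OF n, of w] that by simp
  have new: "Q n (?S (t h - u h)) \<le> eps h" if "h \<in> {i..<L}" for h
  proof (cases "h = i")
    case True
    then show ?thesis using step_current_smooth[OF steps, of i] by (auto intro: Qn)
  next
    case False
    then show ?thesis using that step_new_smooth[OF steps, of i h] by (auto intro: Qn)
  qed
  have newk: "Q n (?S (z h)) \<le> eps h" if "h \<in> {Suc i..<L}" for h
    using that step_new_kick[OF steps, of i h] by (auto intro: Qn)
  have old: "Q n (?S (t h)) \<le> eps i" "Q n (?S (z h)) \<le> eps i" if "h \<in> {..<i}" for h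
    using that step_old_smooth[OF steps, of h i] step_old_kick[OF steps, of h i] by (auto intro: Qn)
  have 1: "Q n (?S (G a i)) \<le> A * (real i * eps i) + A * (real i * eps i)"
  proof -
    have "?S (G a i) = (\<Sum>h<i. sY (a h) (?S (t h))) + (\<Sum>h<i. sY (a (coord_code h)) (?S (z h)))"
      by (simp add: G_def S_sum S_add S_scale sum.distrib)
    then have "Q n (?S (G a i)) \<le> Q n (\<Sum>h<i. sY (a h) (?S (t h)))
        + Q n (\<Sum>h<i. sY (a (coord_code h)) (?S (z h)))"
      using seminorm_add[OF Q_seminorm] by simp
    also have "\<dots> \<le> A * (\<Sum>h<i. eps i) + A * (\<Sum>h<i. eps i)"
      using old by (intro add_mono sum_dominated A) auto
    finally show ?thesis by simp
  qed
  have 2: "Q n (?S (\<Sum>h\<in>{i..<L}. sX (a h) (t h - u h))) \<le> A * (2 * eps i)"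
  proof -
    have "Q n (?S (\<Sum>h\<in>{i..<L}. sX (a h) (t h - u h))) \<le> A * (\<Sum>h\<in>{i..<L}. eps h)"
      unfolding S_sum S_scale using new by (intro sum_dominated A) auto
    also have "\<dots> \<le> A * (2 * eps i)" by (intro mult_left_mono sum_eps_le A0)
    finally show ?thesis .
  qed
  have 3: "Q n (?S (\<Sum>h\<in>{Suc i..<L}. sX (a (coord_code h)) (z h))) \<le> A * (2 * eps i)"
  proof -
    have "Q n (?S (\<Sum>h\<in>{Suc i..<L}. sX (a (coord_code h)) (z h))) \<le> A * (\<Sum>h\<in>{Suc i..<L}. eps h)"
      unfolding S_sum S_scale using newk by (intro sum_dominated A) auto
    also have "\<dots> \<le> A * (2 * eps (Suc i))" by (intro mult_left_mono sum_eps_le A0)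
    also have "\<dots> \<le> A * (2 * eps i)" using eps_pos[of i] A0 by (intro mult_left_mono) (auto simp: eps_Suc)
    finally show ?thesis .
  qed
  have 4: "Q n (sY (a (coord_code i)) (?S (z i) - yy (target_code i))) \<le> A * eps i"
    unfolding seminorm_scale[OF Q_seminorm]
    using step_hit[OF steps, of i] by (intro mult_mono A Qn A0 Q_ge_0)
  have eq: "?S (G a L) - sY (a (coord_code i)) (yy (target_code i))
      = ?S (G a i) + (?S (H a L - H a i) + ?S (\<Sum>h\<in>{i..<L}. sX (a h) (t h - u h))
        + (sY (a (coord_code i)) (?S (z i) - yy (target_code i))
           + ?S (\<Sum>h\<in>{Suc i..<L}. sX (a (coord_code h)) (z h))))"
    unfolding G_split[OF L] S_add S_scale Y.scale_right_diff_distrib by (simp add: algebra_simps)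
  have "Q n (?S (G a L) - sY (a (coord_code i)) (yy (target_code i)))
    \<le> Q n (?S (G a i)) + (Q n (?S (H a L - H a i))
      + Q n (?S (\<Sum>h\<in>{i..<L}. sX (a h) (t h - u h)))
      + (Q n (sY (a (coord_code i)) (?S (z i) - yy (target_code i)))
         + Q n (?S (\<Sum>h\<in>{Suc i..<L}. sX (a (coord_code h)) (z h)))))"
    unfolding eq by (intro order.trans[OF seminorm_add[OF Q_seminorm]] add_mono order.refl)
  then have "Q n (?S (G a L) - sY (a (coord_code i)) (yy (target_code i)))
    \<le> A * (real i * eps i) + A * (real i * eps i) + (\<delta> + A * (2 * eps i)
      + (A * eps i + A * (2 * eps i)))"
    using 1 2 3 4 tail by linarith
  also have "\<dots> = A * real (2 * i + 5) * eps i + \<delta>" by (simp add: algebra_simps)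
  finally show ?thesis .
qed

text \<open>The convergence of \<open>G a\<close> passes to \<open>H a\<close>, because the
  deviations between the two have small tails.\<close>

lemma H_tail:
  assumes x: "expands x a" and e: "e > 0"
  shows "\<exists>N. \<forall>i\<ge>N. \<forall>L\<ge>i. P n (H a L - H a i) < e"
proof -
  define A where "A = 8 * P 0 x"
  have A: "norm (a h) \<le> A" for h unfolding A_def by (rule expands_coeff[OF x])
  have A0: "A \<ge> 0" using P_ge_0 by (simp add: A_def)
  have "(\<lambda>i. A * 4 * eps i) \<longlonglongrightarrow> A * 4 * 0" by (intro tendsto_mult_left eps_tendsto)
  then have "\<forall>\<^sub>F i in sequentially. A * 4 * eps i < e/3" using e by (intro order_tendstoD(2)) auto
  moreover have "\<forall>\<^sub>F i in sequentially. P n (x - G a i) < e/3"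
    using x e by (intro order_tendstoD(2)[of _ 0]) (auto simp: expands_def)
  moreover have "\<forall>\<^sub>F i in sequentially. i \<ge> n" by (rule eventually_ge_at_top)
  ultimately have "\<forall>\<^sub>F i in sequentially. A * 4 * eps i < e/3 \<and> P n (x - G a i) < e/3 \<and> i \<ge> n"
    by eventually_elim simp
  then obtain N where N: "\<And>i. i \<ge> N \<Longrightarrow> A * 4 * eps i < e/3 \<and> P n (x - G a i) < e/3 \<and> i \<ge> n"
    by (auto simp: eventually_sequentially)
  have "P n (H a L - H a i) < e" if i: "i \<ge> N" "L \<ge> i" for i L
  proof -
    have "P n (H a L - H a i) \<le> P n (G a L - G a i) + P n ((G a L - G a i) - (H a L - H a i))"
      using X.seminorm_triangle_sub[OF P_seminorm, of n "H a L - H a i" "G a L - G a i"]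
        X.seminorm_minus_commute[OF P_seminorm, of n "H a L - H a i" "G a L - G a i"] by simp
    also have "P n (G a L - G a i) \<le> P n (x - G a i) + P n (x - G a L)"
      using X.seminorm_diff[OF P_seminorm, of n "x - G a i" "x - G a L"] by simp
    also have "P n ((G a L - G a i) - (H a L - H a i)) \<le> A * (\<Sum>i\<in>{i..<L}. dev n i)"
      using A i by (intro G_minus_H) auto
    also have "\<dots> \<le> A * (4 * eps i)" using N[OF i(1)] A0 by (intro mult_left_mono sum_dev_le) auto
    finally show ?thesis using N[OF i(1)] N[of L] i by simp
  qed
  then show ?thesis by blast
qed

lemma expansions_hypercyclic:
  assumes "x \<in> expansions" "x \<noteq> 0" and e: "e > 0"
  shows "\<exists>i. Q n (S i x - w) < e"
proof -
  obtain a where x: "expands x a" using assms by (auto simp: expansions_def)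
  obtain k0 where k0: "a k0 \<noteq> 0" using expands_nonzero[OF x assms(2)] .
  define A where "A = 8 * P 0 x"
  have A: "norm (a h) \<le> A" for h unfolding A_def by (rule expands_coeff[OF x])
  \<comment> \<open>The orbit will approach \<open>a k0\<close> times the target, so the target must
    approximate \<open>w\<close> divided by \<open>a k0\<close>.\<close>
  obtain l where l: "Q n (yy l - sY (1 / a k0) w) < e / (4 * norm (a k0))"
    using targets_dense[of "e / (4 * norm (a k0))" n "sY (1 / a k0) w"] e k0 by auto
  have target: "Q n (sY (a k0) (yy l) - w) < e/4"
  proof -
    have "sY (a k0) (yy l) - w = sY (a k0) (yy l - sY (1 / a k0) w)"
      using k0 by (simp add: Y.scale_right_diff_distrib)
    then have "Q n (sY (a k0) (yy l) - w) = norm (a k0) * Q n (yy l - sY (1 / a k0) w)"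
      by (simp add: seminorm_scale[OF Q_seminorm])
    also have "\<dots> < norm (a k0) * (e / (4 * norm (a k0)))"
      using l k0 by (intro mult_strict_left_mono) auto
    finally show ?thesis using k0 by simp
  qed
  obtain m k C where C: "C > 0" "\<And>j x. j \<ge> k \<Longrightarrow> x \<in> M j \<Longrightarrow> Q n (S j x) \<le> C * P m x"
    using M_bounded by blast
  obtain N where N: "\<And>i L. i \<ge> N \<Longrightarrow> L \<ge> i \<Longrightarrow> P m (H a L - H a i) < e / (4 * C)"
    using H_tail[OF x, of "e / (4 * C)" m] e C(1) by auto
  have "\<forall>\<^sub>F i in sequentially. A * real (2 * i + 5) * eps i < e/4"
    using e by (intro order_tendstoD(2)[OF eps_linear_tendsto]) auto
  then obtain N' where N': "\<And>i. i \<ge> N' \<Longrightarrow> A * real (2 * i + 5) * eps i < e/4"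
    by (auto simp: eventually_sequentially)
  obtain i where i: "i \<ge> n + k + N + N'" and code: "coord_code i = k0" "target_code i = l"
    using codes_frequent by blast
  have part: "Q n (S (jj i) (G a L) - w) < 3 * e / 4" if L: "L > i" for L
  proof -
    have "H a L - H a i = (\<Sum>h\<in>{i..<L}. sX (a h) (u h))"
      using L by (simp add: H_def lessThan_atLeast0 sum_diff_nat_ivl)
    also have "\<dots> \<in> M (jj i)"
      by (intro X.subspace_sum X.subspace_scale M_subspace basic_in_M) auto
    finally have "Q n (S (jj i) (H a L - H a i)) \<le> C * P m (H a L - H a i)"
      using i index_ge[of i] by (intro C(2)) auto
    also have "\<dots> \<le> C * (e / (4 * C))"
      using N[of i L] i L C(1) by (intro mult_left_mono) auto
    also have "\<dots> = e/4" using C(1) by simp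
    finally have tail: "Q n (S (jj i) (H a L - H a i)) \<le> e/4" .
    have "n \<le> i" using i by simp
    from S_G_estimate[OF A this L tail]
    have "Q n (S (jj i) (G a L) - sY (a k0) (yy l)) \<le> A * real (2 * i + 5) * eps i + e/4"
      unfolding code .
    moreover have "A * real (2 * i + 5) * eps i < e/4" using i by (intro N') simp
    moreover have "Q n (S (jj i) (G a L) - w)
        \<le> Q n (S (jj i) (G a L) - sY (a k0) (yy l)) + Q n (sY (a k0) (yy l) - w)"
      using seminorm_add[OF Q_seminorm, of n "S (jj i) (G a L) - sY (a k0) (yy l)" "sY (a k0) (yy l) - w"]
      by simp
    ultimately show ?thesis using target by simp
  qed
  \<comment> \<open>The estimate \<open>part\<close> is uniform in \<open>L\<close>, so with
    \<open>i\<close> fixed, \<open>L\<close> may be taken large enough to replace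
    \<open>G a L\<close> by \<open>x\<close>; this costs the last quarter of
    \<open>e\<close>.\<close>
  obtain m' C' where C': "C' > 0" "\<And>x. Q n (S (jj i) x) \<le> C' * P m' x" using S_bounded by blast
  have "(\<lambda>L. C' * P m' (x - G a L)) \<longlonglongrightarrow> C' * 0"
    using x by (intro tendsto_mult_left) (simp add: expands_def)
  then have "\<forall>\<^sub>F L in sequentially. C' * P m' (x - G a L) < e/4"
    using e by (intro order_tendstoD(2)) auto
  then have "\<forall>\<^sub>F L in sequentially. C' * P m' (x - G a L) < e/4 \<and> L > i"
    using eventually_gt_at_top[of i] by eventually_elim simp
  then have "\<exists>L. C' * P m' (x - G a L) < e/4 \<and> L > i"
    by (rule eventually_happens'[OF sequentially_bot])
  then obtain L where L: "C' * P m' (x - G a L) < e/4" "L > i" by blast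
  have "Q n (S (jj i) x - w) \<le> Q n (S (jj i) (G a L) - w) + Q n (S (jj i) (x - G a L))"
    using seminorm_add[OF Q_seminorm, of n "S (jj i) (G a L) - w" "S (jj i) (x - G a L)"]
    by (simp add: S_diff)
  also have "\<dots> < 3 * e / 4 + e / 4"
    using part[OF L(2)] C'(2)[of "x - G a L"] L(1) by (intro add_strict_mono) auto
  finally show ?thesis by auto
qed

end

context hypercyclic_data
begin

theorem exists_dense_orbit_subspace:
  "\<exists>E. X.subspace E \<and> infinite_dimensional sX E \<and>
     (\<forall>x. (\<forall>n e. e > 0 \<longrightarrow> (\<exists>g\<in>E. P n (x - g) < e)) \<longrightarrow> x \<in> E) \<and>
     (\<forall>x\<in>E. x \<noteq> 0 \<longrightarrow> (\<forall>w n e. e > 0 \<longrightarrow> (\<exists>i. Q n (S i x - w) < e)))"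
proof -
  obtain f where "\<And>i. step f i (f i)" using stages_exist by blast
  then interpret hypercyclic_stages sX sY P Q S M yy f by unfold_locales
  show ?thesis
    using expansions_subspace expansions_infinite_dimensional expansions_closed expansions_hypercyclic by blast
qed

end


section \<open>Increasing systems of seminorms defining the topology\<close>

definition fundamental ::
  "('k::{real_normed_field, euclidean_space} \<Rightarrow> 'a::{ab_group_add, topological_space} \<Rightarrow> 'a)
     \<Rightarrow> (nat \<Rightarrow> 'a \<Rightarrow> real) \<Rightarrow> bool" where
  "fundamental scl P \<longleftrightarrow>
     (\<forall>n. seminorm scl (P n)) \<and> (\<forall>m n x. m \<le> n \<longrightarrow> P m x \<le> P n x) \<and>
     (\<forall>n. continuous_on UNIV (P n)) \<and>
     (\<forall>U x. open U \<longrightarrow> x \<in> U \<longrightarrow> (\<exists>n e. e > 0 \<and> {y. P n (y - x) < e} \<subseteq> U))"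

locale topological_scalars = normed_scalars scl
  for scl :: "'k::{real_normed_field, euclidean_space}
    \<Rightarrow> 'a::{uniform_topological_group_add, topological_ab_group_add} \<Rightarrow> 'a"
begin

lemma defining_seminorm_continuous:
  assumes p: "seminorms_define_topology scl p" and n: "n \<ge> 1"
  shows "continuous_on UNIV (p n)"
  unfolding continuous_on_open_vimage[OF open_UNIV]
proof (intro allI impI)
  fix B :: "real set" assume B: "open B"
  have pn: "seminorm scl (p n)" using p n by (simp add: seminorms_define_topology_def)
  have "\<exists>N\<ge>1. \<exists>e>0. {y. \<forall>i\<in>{1..N}. p i (y - x) < e} \<subseteq> p n -` B" if xB: "p n x \<in> B" for x
  proof -
    obtain e where e: "e > 0" "ball (p n x) e \<subseteq> B" using B xB unfolding open_contains_ball by blast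
    have "p n y \<in> B" if "p n (y - x) < e" for y
    proof -
      have "\<bar>p n y - p n x\<bar> \<le> p n (y - x)"
        using seminorm_triangle_sub[OF pn, of y x] seminorm_triangle_sub[OF pn, of x y]
          seminorm_minus_commute[OF pn, of x y] by simp
      then show ?thesis using e that by (auto simp: dist_real_def subset_iff)
    qed
    then show ?thesis using n e(1) by (intro exI[of _ n] conjI exI[of _ e]) auto
  qed
  then show "open (p n -` B \<inter> UNIV)"
    using p by (auto simp: seminorms_define_topology_def)
qed

text \<open>Sums make the system increasing. The extra \<open>r\<close> is the continuous norm on
  \<open>X\<close>, so that every member is a norm there, and the zero seminorm on
  \<open>Y\<close>.\<close>

lemma fundamental_partial_sums:
  assumes p: "seminorms_define_topology scl p" and r: "seminorm scl r" "continuous_on UNIV r"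
  shows "fundamental scl (\<lambda>n x. r x + (\<Sum>i\<in>{1..n}. p i x))"
proof -
  have pn: "seminorm scl (p n)" if "n \<ge> 1" for n
    using p that by (simp add: seminorms_define_topology_def)
  have "seminorm scl (\<lambda>x. r x + (\<Sum>i\<in>{1..n}. p i x))" for n
    unfolding seminorm_def
  proof (intro conjI allI)
    fix x y
    have "(\<Sum>i\<in>{1..n}. p i (x + y)) \<le> (\<Sum>i\<in>{1..n}. p i x + p i y)"
      using pn by (intro sum_mono seminorm_add) auto
    then show "r (x + y) + (\<Sum>i\<in>{1..n}. p i (x + y))
        \<le> r x + (\<Sum>i\<in>{1..n}. p i x) + (r y + (\<Sum>i\<in>{1..n}. p i y))"
      using seminorm_add[OF r(1), of x y] by (simp add: sum.distrib)
  next
    fix c x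
    have "(\<Sum>i\<in>{1..n}. p i (scl c x)) = (\<Sum>i\<in>{1..n}. norm c * p i x)"
      using pn by (intro sum.cong refl seminorm_scale) auto
    then show "r (scl c x) + (\<Sum>i\<in>{1..n}. p i (scl c x)) = norm c * (r x + (\<Sum>i\<in>{1..n}. p i x))"
      by (simp add: seminorm_scale[OF r(1)] distrib_left sum_distrib_left)
  qed
  moreover have "(\<Sum>i\<in>{1..m}. p i x) \<le> (\<Sum>i\<in>{1..n}. p i x)" if "m \<le> n" for m n x
    using that pn by (intro sum_mono2) (auto intro: seminorm_ge_0)
  moreover have "continuous_on UNIV (\<lambda>x. r x + (\<Sum>i\<in>{1..n}. p i x))" for n
    using p by (intro continuous_on_add continuous_on_sum r(2) defining_seminorm_continuous) auto
  moreover have "\<exists>n e. e > 0 \<and> {y. r (y - x) + (\<Sum>i\<in>{1..n}. p i (y - x)) < e} \<subseteq> U"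
    if U: "open U" "x \<in> U" for U x
  proof -
    obtain N e where e: "e > 0" "{y. \<forall>i\<in>{1..N}. p i (y - x) < e} \<subseteq> U"
      using p U unfolding seminorms_define_topology_def by blast
    have "p i y \<le> r y + (\<Sum>i\<in>{1..N}. p i y)" if "i \<in> {1..N}" for i y
    proof -
      have "p i y \<le> (\<Sum>i\<in>{1..N}. p i y)"
        using that pn by (intro member_le_sum) (auto intro: seminorm_ge_0)
      then show ?thesis using seminorm_ge_0[OF r(1), of y] by simp
    qed
    then have "{y. r (y - x) + (\<Sum>i\<in>{1..N}. p i (y - x)) < e} \<subseteq> {y. \<forall>i\<in>{1..N}. p i (y - x) < e}"
      by (blast intro: le_less_trans)
    then show ?thesis using e by blast
  qed
  ultimately show ?thesis unfolding fundamental_def by auto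
qed

context
  fixes P :: "nat \<Rightarrow> 'a \<Rightarrow> real"
  assumes P: "fundamental scl P"
begin

lemma fundamental_seminorm: "seminorm scl (P n)"
  using P by (simp add: fundamental_def)

lemma fundamental_mono: "m \<le> n \<Longrightarrow> P m x \<le> P n x"
  using P by (simp add: fundamental_def)

lemma fundamental_continuous: "continuous_on UNIV (P n)"
  using P by (simp add: fundamental_def)

lemma fundamental_nhd: "open U \<Longrightarrow> x \<in> U \<Longrightarrow> \<exists>n e. e > 0 \<and> {y. P n (y - x) < e} \<subseteq> U"
  using P unfolding fundamental_def by blast

lemma fundamental_open_ball: "open {y. P n (y - x) < e}"
proof (rule open_Collect_less)
  show "continuous_on UNIV (\<lambda>y. P n (y - x))"
    by (rule continuous_on_compose2[OF fundamental_continuous]) (auto intro!: continuous_intros)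
qed simp

lemma fundamental_closure_iff: "w \<in> closure A \<longleftrightarrow> (\<forall>n e. e > 0 \<longrightarrow> (\<exists>a\<in>A. P n (a - w) < e))"
proof
  assume w: "w \<in> closure A"
  show "\<forall>n e. e > 0 \<longrightarrow> (\<exists>a\<in>A. P n (a - w) < e)"
  proof (intro allI impI)
    fix n and e :: real assume "e > 0"
    then have "w \<in> {y. P n (y - w) < e}" by (simp add: seminorm_zero[OF fundamental_seminorm])
    then have "{y. P n (y - w) < e} \<inter> A \<noteq> {}"
      using open_Int_closure_eq_empty[OF fundamental_open_ball, of n w e A] w by blast
    then show "\<exists>a\<in>A. P n (a - w) < e" by blast
  qed
next
  assume near: "\<forall>n e. e > 0 \<longrightarrow> (\<exists>a\<in>A. P n (a - w) < e)"
  show "w \<in> closure A"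
    unfolding closure_iff_nhds_not_empty
  proof (intro allI impI)
    fix U V assume V: "V \<subseteq> U" "open V" "w \<in> V"
    obtain n e where e: "e > 0" "{y. P n (y - w) < e} \<subseteq> V"
      using fundamental_nhd[OF V(2,3)] by blast
    obtain a where "a \<in> A" "P n (a - w) < e" using near e(1) by blast
    then show "A \<inter> U \<noteq> {}" using e(2) V(1) by blast
  qed
qed

lemma fundamental_dominates:
  assumes s: "seminorm scl s" "continuous_on UNIV s"
  shows "\<exists>m. \<exists>C>0. \<forall>x. s x \<le> C * P m x"
proof -
  have "open {y. s y < 1}" using s(2) by (intro open_Collect_less) auto
  moreover have "0 \<in> {y. s y < 1}" by (simp add: seminorm_zero[OF s(1)])
  ultimately obtain m e where e: "e > 0" "\<And>y. P m y < e \<Longrightarrow> s y < 1"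
    using fundamental_nhd[of "{y. s y < 1}" 0] by auto
  have "s x \<le> (2/e) * P m x" for x
  proof (rule field_le_epsilon)
    fix d :: real assume d: "d > 0"
    \<comment> \<open>Being strictly larger than \<open>P m x\<close>, \<open>b\<close> is positive
      even where \<open>P m x\<close> vanishes; the excess contributes exactly \<open>d\<close>
      after multiplication by \<open>2/e\<close>.\<close>
    define b where "b = P m x + d * e / 2"
    have b: "b > 0" "b > P m x"
      using seminorm_ge_0[OF fundamental_seminorm, of m x] d e(1) by (auto simp: b_def intro: add_nonneg_pos)
    define c where "c = e / (2 * b)"
    have c: "c > 0" using e(1) b by (simp add: c_def)
    have "P m (scl (of_real c) x) = c * P m x"
      using c by (simp add: seminorm_scale[OF fundamental_seminorm])
    also have "\<dots> \<le> c * b" using b c by simp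
    also have "\<dots> < e" using e(1) b by (simp add: c_def)
    finally have "s (scl (of_real c) x) < 1" by (rule e(2))
    then have "c * s x < 1" using c by (simp add: seminorm_scale[OF s(1)])
    then have "e * s x < 2 * b" using b by (simp add: c_def field_simps)
    then have "s x < (2/e) * b" using e(1) b by (simp add: field_simps)
    then show "s x \<le> (2/e) * P m x + d" using e(1) by (simp add: b_def field_simps)
  qed
  then show ?thesis using e(1) by (intro exI[of _ m] exI[of _ "2/e"]) auto
qed

lemma fundamental_tendsto: "\<xi> \<longlonglongrightarrow> l \<Longrightarrow> (\<lambda>i. P n (\<xi> i - l)) \<longlonglongrightarrow> 0"
proof -
  assume "\<xi> \<longlonglongrightarrow> l"
  then have "(\<lambda>i. \<xi> i - l) \<longlonglongrightarrow> l - l" by (intro tendsto_diff tendsto_const)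
  then have "(\<lambda>i. P n (\<xi> i - l)) \<longlonglongrightarrow> P n (l - l)"
    by (intro continuous_on_tendsto_compose[OF fundamental_continuous]) auto
  then show ?thesis by (simp add: seminorm_zero[OF fundamental_seminorm])
qed

text \<open>The uniformity is generated by differences near 0, so a sequence that is Cauchy for
  every \<open>P n\<close> is Cauchy in the uniform sense.\<close>

lemma fundamental_complete:
  assumes complete: "complete (UNIV :: 'a set)"
    and cauchy: "\<And>n e. e > 0 \<Longrightarrow> \<exists>N. \<forall>i\<ge>N. \<forall>j\<ge>N. P n (\<xi> i - \<xi> j) < e"
  shows "\<exists>l. \<forall>n. (\<lambda>i. P n (\<xi> i - l)) \<longlonglongrightarrow> 0"
proof -
  have "Cauchy \<xi>"
    unfolding Cauchy_uniform_iff
  proof (intro allI impI)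
    fix R :: "'a \<times> 'a \<Rightarrow> bool" assume "eventually R uniformity"
    then obtain U where U: "open U" "0 \<in> U" "\<And>x y. y - x \<in> U \<Longrightarrow> R (x, y)"
      unfolding cauchy_seq_finset_iff_vanishing eventually_filtercomap eventually_nhds by auto
    obtain n e where "e > 0" "{y. P n (y - 0) < e} \<subseteq> U" using fundamental_nhd[OF U(1,2)] by blast
    moreover obtain N where "\<forall>i\<ge>N. \<forall>j\<ge>N. P n (\<xi> i - \<xi> j) < e" using cauchy[OF \<open>e > 0\<close>] by blast
    ultimately show "\<exists>N. \<forall>n\<ge>N. \<forall>m\<ge>N. R (\<xi> n, \<xi> m)"
      by (intro exI[of _ N]) (auto intro!: U(3))
  qed
  then have "cauchy_filter (filtermap \<xi> sequentially)" by (simp add: Cauchy_uniform)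
  from cauchy_filter_complete_converges[OF this complete]
  obtain l where "\<xi> \<longlonglongrightarrow> l" by (auto simp: filterlim_def filtermap_bot_iff)
  then show ?thesis using fundamental_tendsto by blast
qed

end

end


section \<open>From the topological hypotheses to seminorm data and back\<close>

theorem theorem1p11:
  fixes scaleX :: "'k::{real_normed_field, euclidean_space}
      \<Rightarrow> 'a::{uniform_topological_group_add, topological_ab_group_add, t2_space} \<Rightarrow> 'a"
    and scaleY :: "'k
      \<Rightarrow> 'b::{uniform_topological_group_add, topological_ab_group_add, t2_space} \<Rightarrow> 'b"
    and T :: "nat \<Rightarrow> 'a \<Rightarrow> 'b"
    and p :: "nat \<Rightarrow> 'a \<Rightarrow> real"
    and q :: "nat \<Rightarrow> 'b \<Rightarrow> real"
    and nn :: "nat \<Rightarrow> nat"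
    and M :: "nat \<Rightarrow> 'a set"
  assumes "frechet_space scaleX"
    and "infinite_dimensional scaleX (UNIV :: 'a set)"
    and "has_continuous_norm scaleX"
    and "frechet_space scaleY"
    and "separable (UNIV :: 'b set)"
    and "\<And>n. n \<ge> 1 \<Longrightarrow> Vector_Spaces.linear scaleX scaleY (T n)"
    and "\<And>n. n \<ge> 1 \<Longrightarrow> continuous_on UNIV (T n)"
    and "seminorms_define_topology scaleX p"
    and "seminorms_define_topology scaleY q"
    and "\<And>k. k \<ge> 1 \<Longrightarrow> nn k \<ge> 1"
    and "strict_mono_on {1..} nn"
    and "condition_C scaleX T nn"
    and "\<And>j. j \<ge> 1 \<Longrightarrow> module.subspace scaleX (M j)"
    and "\<And>j. j \<ge> 1 \<Longrightarrow> closed (M j)"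
    and "\<And>j. j \<ge> 1 \<Longrightarrow> infinite_dimensional scaleX (M j)"
    and "\<And>j. j \<ge> 1 \<Longrightarrow> M (Suc j) \<subseteq> M j"
    and "\<And>n. n \<ge> 1 \<Longrightarrow> \<exists>C>0. \<exists>m\<ge>1. \<exists>k\<ge>1. \<forall>j\<ge>k. \<forall>x\<in>M j. q n (T (nn j) x) \<le> C * p m x"
  shows "\<exists>S. hypercyclic_subspace scaleX T S"
proof -
  interpret X: topological_scalars scaleX
    using assms(1) by (simp add: frechet_space_def topological_scalars_def normed_scalars_def)
  interpret Y: topological_scalars scaleY
    using assms(4) by (simp add: frechet_space_def topological_scalars_def normed_scalars_def)
  obtain \<rho> where \<rho>: "seminorm scaleX \<rho>" "\<And>x. \<rho> x = 0 \<Longrightarrow> x = 0" "continuous_on UNIV \<rho>"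
    using assms(3) unfolding has_continuous_norm_def by blast
  define P where "P = (\<lambda>n x. \<rho> x + (\<Sum>i\<in>{1..n}. p i x))"
  define Q where "Q = (\<lambda>n y. 0 + (\<Sum>i\<in>{1..n}. q i y))"
  have P: "fundamental scaleX P"
    unfolding P_def by (intro X.fundamental_partial_sums assms(8) \<rho>)
  have Q: "fundamental scaleY Q"
    unfolding Q_def by (intro Y.fundamental_partial_sums assms(9)) (auto simp: seminorm_def)
  note P_simps = X.fundamental_seminorm[OF P] X.fundamental_mono[OF P]
  note Q_simps = Y.fundamental_seminorm[OF Q] Y.fundamental_mono[OF Q]
  \<comment> \<open>The shift moves the first index from 1 to 0; \<open>M\<close> is shifted in the
    same way below.\<close>
  define S where "S = (\<lambda>j. T (nn (Suc j)))"
  have S1: "nn (Suc j) \<ge> 1" for j by (rule assms(10)) simp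
  have lin: "Vector_Spaces.linear scaleX scaleY (S j)" for j
    unfolding S_def by (rule assms(6)[OF S1])
  have S_add: "S j (x + y) = S j x + S j y" and S_scale: "S j (scaleX c x) = scaleY c (S j x)" for j x y c
    using lin[of j] by (auto simp: Vector_Spaces.linear_iff)
  have S_cont: "continuous_on UNIV (S j)" for j
    unfolding S_def by (rule assms(7)[OF S1])
  obtain D where D: "countable D" "closure D = (UNIV :: 'b set)"
    using assms(5) unfolding separable_def by blast
  then have "D \<noteq> {}" by auto
  define yy where "yy = from_nat_into D"
  have yy: "range yy = D" unfolding yy_def using \<open>D \<noteq> {}\<close> D(1) by (rule range_from_nat_into)
  obtain X0 where X0: "closure X0 = UNIV" "\<And>x. x \<in> X0 \<Longrightarrow> (\<lambda>k. T (nn k) x) \<longlonglongrightarrow> 0"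
    using assms(12) unfolding condition_C_def by blast
  have p_le: "p m x \<le> P m x" if "m \<ge> 1" for m x
  proof -
    have "p m x \<le> (\<Sum>i\<in>{1..m}. p i x)"
      using that assms(8) by (intro member_le_sum) (auto simp: seminorms_define_topology_def intro: X.seminorm_ge_0)
    then show ?thesis using X.seminorm_ge_0[OF \<rho>(1), of x] by (simp add: P_def)
  qed
  interpret hypercyclic_data scaleX scaleY P Q S "\<lambda>j. M (Suc j)" yy
  proof unfold_locales
    show "x = 0" if "P 0 x = 0" for x using that \<rho>(2) by (simp add: P_def)
    show "\<exists>l. \<forall>n. (\<lambda>i. P n (\<xi> i - l)) \<longlonglongrightarrow> 0"
      if "\<And>n e. e > 0 \<Longrightarrow> \<exists>N. \<forall>i\<ge>N. \<forall>j\<ge>N. P n (\<xi> i - \<xi> j) < e" for \<xi>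
      using assms(1) that by (intro X.fundamental_complete[OF P]) (auto simp: frechet_space_def frechet_space_axioms_def)
    show "\<exists>m. \<exists>C>0. \<forall>x. Q n (S j x) \<le> C * P m x" for n j
    proof (rule X.fundamental_dominates[OF P])
      show "seminorm scaleX (\<lambda>x. Q n (S j x))"
        using seminorm_add[OF Q_simps(1)] seminorm_scale[OF Q_simps(1)]
        by (simp add: seminorm_def S_add S_scale)
      show "continuous_on UNIV (\<lambda>x. Q n (S j x))"
        by (rule continuous_on_compose2[OF Y.fundamental_continuous[OF Q] S_cont]) simp
    qed
    show "\<exists>x'. (\<forall>n. (\<lambda>j. Q n (S j x')) \<longlonglongrightarrow> 0) \<and> P n (x - x') < e" if e0: "e > 0" for e n x
    proof -
      have "x \<in> closure X0" by (simp add: X0)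
      then obtain x' where x': "x' \<in> X0" "P n (x' - x) < e"
        using e0 unfolding X.fundamental_closure_iff[OF P] by blast
      have "(\<lambda>j. S j x') \<longlonglongrightarrow> 0" unfolding S_def using X0(2)[OF x'(1)] by (rule LIMSEQ_Suc)
      then have "(\<lambda>j. Q m (S j x' - 0)) \<longlonglongrightarrow> 0" for m by (rule Y.fundamental_tendsto[OF Q])
      then show ?thesis
        using x'(2) X.seminorm_minus_commute[OF P_simps(1), of n x x']
        by (intro exI[of _ x']) auto
    qed
    show "\<exists>j z. P n z < e \<and> Q m (S j z - w) < e" if e: "e > 0" for e n m w
    proof -
      \<comment> \<open>Condition (C) speaks of unit balls; dividing by \<open>e\<close> turns the
        ball of radius \<open>e\<close> into one.\<close>
      have "seminorm scaleX (\<lambda>x. P n x / e)"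
        using seminorm_add[OF P_simps(1)] seminorm_scale[OF P_simps(1)] e
        by (simp add: seminorm_def add_divide_distrib[symmetric] divide_right_mono)
      moreover have "continuous_on UNIV (\<lambda>x. P n x / e)"
        using e by (intro continuous_on_divide X.fundamental_continuous[OF P] continuous_on_const) auto
      ultimately have "w \<in> closure (\<Union>k\<in>{1..}. T (nn k) ` {x. P n x / e < 1})"
        using assms(12) unfolding condition_C_def by blast
      then obtain k z where k: "k \<ge> 1" "P n z / e < 1" "Q m (T (nn k) z - w) < e"
        using e unfolding Y.fundamental_closure_iff[OF Q] by fastforce
      then have "Q m (S (k - 1) z - w) < e" by (simp add: S_def)
      then show ?thesis using k(2) e by auto
    qed
    show "\<exists>l. Q n (yy l - w) < e" if "e > 0" for e n w
    proof -
      have "w \<in> closure (range yy)" using D(2) yy by simp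
      then show ?thesis using that unfolding Y.fundamental_closure_iff[OF Q] by blast
    qed
    \<comment> \<open>\<open>Q n\<close> is a sum of the first \<open>n\<close> seminorms, so the
      separate bounds are accumulated by induction, starting from \<open>Q 0 = 0\<close>.\<close>
    show "\<exists>m k. \<exists>C>0. \<forall>j\<ge>k. \<forall>x\<in>M (Suc j). Q n (S j x) \<le> C * P m x" for n
    proof (induction n)
      case 0
      show ?case
        by (intro exI[of _ 0] exI[of _ "1::real"]) (auto simp: Q_def X.seminorm_ge_0[OF P_simps(1)])
    next
      case (Suc n)
      then obtain m k C where 1: "C > 0" "\<And>j x. j \<ge> k \<Longrightarrow> x \<in> M (Suc j) \<Longrightarrow> Q n (S j x) \<le> C * P m x"
        by blast
      have "Suc n \<ge> 1" by simp
      from assms(17)[OF this] obtain m' k' C' where 2: "C' > 0" "m' \<ge> 1"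
        "\<And>j x. j \<ge> k' \<Longrightarrow> x \<in> M j \<Longrightarrow> q (Suc n) (T (nn j) x) \<le> C' * p m' x" by blast
      have "Q (Suc n) (S j x) \<le> (C + C') * P (max m m') x"
        if "j \<ge> max k k'" "x \<in> M (Suc j)" for j x
      proof -
        have "Q (Suc n) (S j x) = Q n (S j x) + q (Suc n) (S j x)" by (simp add: Q_def)
        also have "\<dots> \<le> C * P m x + C' * P m' x"
        proof (rule add_mono)
          show "Q n (S j x) \<le> C * P m x" using that by (intro 1(2)) auto
          have "q (Suc n) (S j x) \<le> C' * p m' x" unfolding S_def using that by (intro 2(3)) auto
          also have "\<dots> \<le> C' * P m' x" using 2(1) p_le[OF 2(2)] by (intro mult_left_mono) auto
          finally show "q (Suc n) (S j x) \<le> C' * P m' x" .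
        qed
        also have "\<dots> \<le> C * P (max m m') x + C' * P (max m m') x"
          using 1(1) 2(1) by (intro add_mono mult_left_mono P_simps(2)) auto
        finally show ?thesis by (simp add: algebra_simps)
      qed
      moreover have "C + C' > 0" using 1(1) 2(1) by simp
      ultimately show ?case by blast
    qed
  qed (use P_simps Q_simps S_add S_scale assms(13,15,16) in auto)
  obtain E where E: "X.subspace E" "infinite_dimensional scaleX E"
    "\<And>x. (\<And>n e. e > 0 \<Longrightarrow> \<exists>g\<in>E. P n (x - g) < e) \<Longrightarrow> x \<in> E"
    "\<And>x w n e. x \<in> E \<Longrightarrow> x \<noteq> 0 \<Longrightarrow> e > 0 \<Longrightarrow> \<exists>i. Q n (S i x - w) < e"
    using exists_dense_orbit_subspace by (metis (no_types, lifting))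
  have "closure E \<subseteq> E"
  proof
    fix x assume "x \<in> closure E"
    then show "x \<in> E"
      unfolding X.fundamental_closure_iff[OF P]
      by (intro E(3)) (metis X.seminorm_minus_commute[OF P_simps(1)])
  qed
  then have "closed E" by (simp add: closure_subset_eq)
  moreover have "hypercyclic_vector T x" if x: "x \<in> E" "x \<noteq> 0" for x
  proof -
    \<comment> \<open>Density already holds along the subsequence \<open>nn (Suc i)\<close>, whose
      members are at least 1.\<close>
    have "\<exists>v\<in>(\<lambda>n. T n x) ` {1..}. Q n (v - w) < e" if "e > 0" for w n e
      using E(4)[OF x that, of n w] S1 by (auto simp: S_def)
    then show ?thesis
      unfolding hypercyclic_vector_def using Y.fundamental_closure_iff[OF Q] by blast
  qed
  ultimately show ?thesis
    using E(1,2) unfolding hypercyclic_subspace_def by blast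
qed

end
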